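(* For all positive integers $k$ and $d$ there exists $n$ with the following property: for every linear ordering $\prec$ of $[k]^n$ there is a $d$-subcube $C$ of $[k]^n$ such that the restriction of $\prec$ to $C$ (viewed, via the canonical bijection, as a linear ordering of $[k]^d$) equals $\prec_T$ on $[k]^d$ for some weakly decreasing Schröder tree $T$ with $k$ leaves and some linear ordering $<$ of $[k]$.
   Context: Elements of $[k]^n$ ($[k]=\{1,\dotsc,k\}$) are words of length $n$ over $[k]$. A $d$-parameter word of length $n$ is a word $p$ of length $n$ over $[k]\cup\{*_1,\dotsc,*_d\}$ containing each $*_i$ at least once; for a word $w$ of length $d$, $p[w]$ is obtained from $p$ by replacing each $*_i$ by $w_i$. The set $\{p[w]:w\in[k]^d\}$ is a $d$-subcube. A parameter word is canonical if the first occurrences of $*_1,*_2,\dotsc,*_d$ appear in this order; each $d$-subcube is induced by a unique canonical $p$, and $w\mapsto p[w]$ is the canonical bijection. The restriction of a linear ordering $\prec$ of $[k]^n$ to the subcube is the ordering on $[k]^d$ given by $w\prec w'$ iff $p[w]\prec p[w']$. A Schröder tree is a rooted plane tree (children of each node are ordered) in which every internal node has at least $2$ children. A weakly decreasing Schröder tree is a Schröder tree together with a total preorder $\preceq_T$ (transitive, reflexive, any two nodes comparable) on its internal nodes such that every path from the root is strictly decreasing with respect to $\preceq_T$. Given a linear ordering $<$ of $[k]$ and a weakly decreasing Schröder tree $T$ with $k$ leaves, identify the leaves (in their left-to-right plane order) with the elements of $[k]$ listed in increasing $<$-order. For distinct $a,b\in[k]$, $[a,b]_T$ denotes the lowest internal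 node of $T$ having both leaves $a$ and $b$ as descendants. The ordering $\prec_T$ on $[k]^d$: for distinct words $w,w'$, let $i$ be the smallest index with $w_i\neq w'_i$ such that $[w_j,w'_j]_T\preceq_T[w_i,w'_i]_T$ for all $j$ with $w_j\ne w'_j$; then $w\prec_T w'$ iff $w_i<w'_i$. *)

theory Defs
  imports Main "HOL-Library.Sublist"
begin

definition strict_linear_ordering :: "'a set \<Rightarrow> 'a rel \<Rightarrow> bool" where
  "strict_linear_ordering A r \<longleftrightarrow> r \<subseteq> A \<times> A \<and> strict_linear_order_on A r"

text \<open>Words are lists over \<open>{1..k}\<close>. Positions in words and indices of wildcards start at \<open>0\<close>,
  so \<open>Star i\<close> is the wildcard that is written with index \<open>i + 1\<close> on paper, and it is replaced by
  the letter \<open>w ! i\<close>.\<close>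

definition words :: "nat \<Rightarrow> nat \<Rightarrow> nat list set" where
  "words k n = {w. length w = n \<and> set w \<subseteq> {1..k}}"

datatype symbol = Letter nat | Star nat

definition param_words :: "nat \<Rightarrow> nat \<Rightarrow> nat \<Rightarrow> symbol list set" where
  "param_words k d n = {p. length p = n
     \<and> set p \<subseteq> Letter ` {1..k} \<union> Star ` {..<d}
     \<and> Star ` {..<d} \<subseteq> set p}"

fun subst_symbol :: "nat list \<Rightarrow> symbol \<Rightarrow> nat" where
  "subst_symbol w (Letter a) = a"
| "subst_symbol w (Star i) = w ! i"

definition subst_word :: "symbol list \<Rightarrow> nat list \<Rightarrow> nat list" where
  "subst_word p w = map (subst_symbol w) p"

definition induced_subcube :: "nat \<Rightarrow> nat \<Rightarrow> symbol list \<Rightarrow> nat list set" where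
  "induced_subcube k d p = subst_word p ` words k d"

definition subcubes :: "nat \<Rightarrow> nat \<Rightarrow> nat \<Rightarrow> nat list set set" where
  "subcubes k d n = induced_subcube k d ` param_words k d n"

definition first_occurrence :: "symbol list \<Rightarrow> nat \<Rightarrow> nat" where
  "first_occurrence p i = (LEAST m. m < length p \<and> p ! m = Star i)"

definition canonical_param_words :: "nat \<Rightarrow> nat \<Rightarrow> nat \<Rightarrow> symbol list set" where
  "canonical_param_words k d n =
     {p \<in> param_words k d n. strict_mono_on {..<d} (first_occurrence p)}"

definition restrict_ordering :: "nat \<Rightarrow> nat \<Rightarrow> nat list rel \<Rightarrow> symbol list \<Rightarrow> nat list rel" where
  "restrict_ordering k d R p =
     {(w, w'). w \<in> words k d \<and> w' \<in> words k d \<and> (subst_word p w, subst_word p w') \<in> R}"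

datatype plane_tree = Leaf | Node "plane_tree list"

primrec schroeder_tree :: "plane_tree \<Rightarrow> bool" where
  "schroeder_tree Leaf \<longleftrightarrow> True"
| "schroeder_tree (Node ts) \<longleftrightarrow> length ts \<ge> 2 \<and> list_all id (map schroeder_tree ts)"

text \<open>A node is represented by its path from the root, i.e. the list of child indices (starting at
  \<open>0\<close>) that leads to it. So \<open>prefix p q\<close> says that \<open>q\<close> is a descendant of \<open>p\<close> (or \<open>p\<close> itself), and
  \<open>length p\<close> is the depth of \<open>p\<close>.\<close>

text \<open>The leaves from left to right.\<close>
primrec leaves :: "plane_tree \<Rightarrow> nat list list" where
  "leaves Leaf = [[]]"
| "leaves (Node ts) =
     concat (map2 (\<lambda>i ls. map ((#) i) ls) [0..<length ts] (map leaves ts))"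

primrec internal_nodes :: "plane_tree \<Rightarrow> nat list set" where
  "internal_nodes Leaf = {}"
| "internal_nodes (Node ts) =
     insert [] (\<Union> (set (map2 (\<lambda>i N. (#) i ` N) [0..<length ts] (map internal_nodes ts))))"

text \<open>\<open>(q, p) \<in> le\<close> stands for \<open>q\<close> preceding \<open>p\<close> in the weak order of the tree.\<close>
definition weakly_decreasing_schroeder_tree :: "plane_tree \<Rightarrow> nat list rel \<Rightarrow> bool" where
  "weakly_decreasing_schroeder_tree T le \<longleftrightarrow>
     schroeder_tree T
     \<and> preorder_on (internal_nodes T) le \<and> total_on (internal_nodes T) le
     \<and> (\<forall>p \<in> internal_nodes T. \<forall>q \<in> internal_nodes T.
          strict_prefix p q \<longrightarrow> (q, p) \<in> le \<and> (p, q) \<notin> le)"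

text \<open>The leaf identified with the letter \<open>a\<close> when the letters are listed in increasing \<open>lt\<close>-order.\<close>
definition leaf_of :: "nat \<Rightarrow> nat rel \<Rightarrow> plane_tree \<Rightarrow> nat \<Rightarrow> nat list" where
  "leaf_of k lt T a = leaves T ! card {b \<in> {1..k}. (b, a) \<in> lt}"

definition lowest_common :: "nat \<Rightarrow> nat rel \<Rightarrow> plane_tree \<Rightarrow> nat \<Rightarrow> nat \<Rightarrow> nat list" where
  "lowest_common k lt T a b =
     (ARG_MAX length p. p \<in> internal_nodes T
        \<and> prefix p (leaf_of k lt T a) \<and> prefix p (leaf_of k lt T b))"

definition decisive_index ::
    "nat \<Rightarrow> nat \<Rightarrow> nat rel \<Rightarrow> plane_tree \<Rightarrow> nat list rel \<Rightarrow> nat list \<Rightarrow> nat list \<Rightarrow> nat" where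
  "decisive_index k d lt T le w w' =
     (LEAST i. i < d \<and> w ! i \<noteq> w' ! i
        \<and> (\<forall>j<d. w ! j \<noteq> w' ! j \<longrightarrow>
             (lowest_common k lt T (w ! j) (w' ! j), lowest_common k lt T (w ! i) (w' ! i)) \<in> le))"

definition tree_ordering ::
    "nat \<Rightarrow> nat \<Rightarrow> nat rel \<Rightarrow> plane_tree \<Rightarrow> nat list rel \<Rightarrow> nat list rel" where
  "tree_ordering k d lt T le =
     {(w, w'). w \<in> words k d \<and> w' \<in> words k d \<and> w \<noteq> w'
        \<and> (let i = decisive_index k d lt T le w w' in (w ! i, w' ! i) \<in> lt)}"

end

theory Submission
  imports Defs "HOL-Library.Nat_Bijection"
begin

text \<open>By the Graham--Rothschild theorem we may pass to a subcube in which the comparison of two words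
  \<open>w\<close>, \<open>w'\<close> depends only on the order in which the column types \<open>(w\<^sub>i, w'\<^sub>i)\<close> with
  \<open>w\<^sub>i \<noteq> w'\<^sub>i\<close> first occur. Comparing constant words gives the linear order of the letters. For two
  intervals of letters, one going up in an earlier column and the other going down in a later
  column, record whether the first one wins; transitivity of the order on words, applied to short
  cycles of words, shows that this is a total preorder on intervals in which \<open>[a, c]\<close> is equivalent
  to the larger of \<open>[a, b]\<close> and \<open>[b, c]\<close>. Duplicating a column changes nothing, so the first
  column of maximal weight can be played off against all other columns one at a time, and it decides
  the comparison. Since the weight of an interval is the maximum of the weights of its gaps, cutting
  the letters recursively at the gaps of maximal weight yields the tree.\<close>

section \<open>The Graham--Rothschild theorem\<close>

text \<open>A pair of words is one parameter word evaluated at two points, with one parameter per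
  off-diagonal column type. So the relation that the given order induces on the points of a
  parameter word can serve as its colour, and a subspace of constant colour makes every comparison a
  function of the two points alone. The objects coloured are parameter words rather than points, so
  the Hales-Jewett theorem is not enough. Graham-Rothschild is derived from it by induction on the
  number of parameters, for all alphabets at once, because the part of a word behind its first
  parameter is a word over one more letter.

  The cycles of words insert duplicate or constant columns. Hence the order has to be controlled on
  words that are longer than those of the final subcube, and words of different lengths have to be
  comparable in type; padding inside one larger cube provides both.\<close>

text \<open>Here letters are \<open>0, \<dots>, k - 1\<close> and the parameters are \<open>k, \<dots>, k + m - 1\<close>, so that the part
  after the first parameter is again a canonical word, with \<open>k + 1\<close> letters and \<open>m - 1\<close>
  parameters.\<close>

fun pword :: "nat \<Rightarrow> nat \<Rightarrow> nat list \<Rightarrow> bool" where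
  "pword k m [] \<longleftrightarrow> m = 0"
| "pword k m (x # xs) \<longleftrightarrow> x < k \<and> pword k m xs \<or> x = k \<and> m > 0 \<and> pword (Suc k) (m - 1) xs"

definition pwords :: "nat \<Rightarrow> nat \<Rightarrow> nat \<Rightarrow> nat list set" where
  "pwords k m n = {p. pword k m p \<and> length p = n}"

definition psub :: "nat \<Rightarrow> nat list \<Rightarrow> nat list \<Rightarrow> nat list" where
  "psub k q p = map (\<lambda>x. if x < k then x else q ! (x - k)) p"

section \<open>Composition of canonical parameter words\<close>

lemma length_psub [simp]: "length (psub k q p) = length p"
  by (simp add: psub_def)

lemma psub_append [simp]: "psub k q (p @ p') = psub k q p @ psub k q p'"
  by (simp add: psub_def)

lemma pword_less: "pword k m p \<Longrightarrow> x \<in> set p \<Longrightarrow> x < k + m"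
  by (induction k m p rule: pword.induct) force+

lemma pword_0: "pword k 0 p \<longleftrightarrow> (\<forall>x\<in>set p. x < k)"
  by (induction p) auto

lemma finite_pwords: "finite (pwords k m n)"
proof (rule finite_subset)
  show "pwords k m n \<subseteq> {p. set p \<subseteq> {..<k+m} \<and> length p = n}"
    by (auto simp: pwords_def dest: pword_less)
qed (rule finite_lists_length_eq, simp)

lemma pword_append: "pword k l p \<Longrightarrow> pword (k + l) m q \<Longrightarrow> pword k (l + m) (p @ q)"
proof (induction p arbitrary: k l)
  case (Cons x p)
  show ?case
  proof (cases "x < k")
    case True
    with Cons show ?thesis by auto
  next
    case False
    with Cons.prems have "x = k" "l > 0" "pword (Suc k) (l - 1) p" by auto
    moreover have "pword (Suc k + (l - 1)) m q" using Cons.prems \<open>l > 0\<close> by simp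
    ultimately show ?thesis using Cons.IH[of "Suc k" "l - 1"] by simp
  qed
qed simp

lemma pword_upt: "pword k l [k..<k + l]"
proof (induction l)
  case (Suc l)
  have "pword (k + l) 1 [k + l]" by simp
  from pword_append[OF Suc this] show ?case by simp
qed simp

text \<open>Induction along \<open>p\<close>: \<open>q\<close> holds the values of the parameters
  already met, so its entries count as letters over \<open>K\<close>, and \<open>q'\<close> holds
  the values still to come. Reading the value \<open>K\<close> opens a new parameter of the result
  and enlarges its alphabet by one.\<close>

lemma pword_psub_aux:
  assumes "pword (k + length q) (length q') p" "\<forall>x\<in>set q. x < K" "pword K m q'" "k \<le> K"
  shows "pword K m (psub k (q @ q') p)"
  using assms
proof (induction p arbitrary: q q' K m)
  case Nil
  then show ?case by (simp add: psub_def)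
next
  case (Cons x p)
  let ?f = "\<lambda>x. if x < k then x else (q @ q') ! (x - k)"
  show ?case
  proof (cases "x < k + length q")
    case True
    with Cons.prems have "pword (k + length q) (length q') p" by auto
    from Cons.IH[OF this] Cons.prems have "pword K m (psub k (q @ q') p)" by blast
    moreover have "?f x < K"
      using True Cons.prems by (auto simp: nth_append)
    ultimately show ?thesis by (simp add: psub_def)
  next
    case False
    with Cons.prems have x: "x = k + length q" and p: "length q' > 0" "pword (Suc (k + length q)) (length q' - 1) p"
      by auto
    then obtain y ys where q': "q' = y # ys" by (cases q') auto
    have fx: "?f x = y" using x q' by simp
    have p': "pword (k + length (q @ [y])) (length ys) p" using p q' by simp
    show ?thesis
    proof (cases "y < K")
      case True
      with Cons.prems q' have "pword K m ys" by auto
      with Cons.IH[OF p' _ this] Cons.prems True have "pword K m (psub k (q @ q') p)" by (simp add: q')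
      with True fx show ?thesis by (simp add: psub_def)
    next
      case False
      with Cons.prems q' have y: "y = K" "m > 0" "pword (Suc K) (m - 1) ys" by auto
      have "pword (Suc K) (m - 1) (psub k ((q @ [y]) @ ys) p)"
        by (rule Cons.IH[OF p' _ y(3)]) (use Cons.prems y in \<open>auto simp: less_SucI\<close>)
      then have "pword (Suc K) (m - 1) (psub k (q @ q') p)" by (simp add: q')
      moreover have "psub k (q @ q') (x # p) = y # psub k (q @ q') p" using fx by (simp add: psub_def)
      ultimately show ?thesis using y by simp
    qed
  qed
qed

text \<open>The case \<open>k < K\<close> lets a subspace over \<open>k\<close> letters carry lines
  and subspaces over \<open>k + 1\<close> letters, which drives both inductions leading to
  Graham-Rothschild.\<close>

lemma psub_in_pwords:
  assumes "p \<in> pwords k l n" "q \<in> pwords K m l" "k \<le> K"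
  shows "psub k q p \<in> pwords K m n"
  using pword_psub_aux[of k "[]" q p K m] assms by (auto simp: pwords_def)

lemma psub_psub:
  assumes "p \<in> pwords k l n" "length q = l" "k \<le> K"
  shows "psub K r (psub k q p) = psub k (psub K r q) p"
proof -
  have "x - k < l \<or> x < k" if "x \<in> set p" for x
    using assms pword_less[of k l p x] that by (auto simp: pwords_def)
  with assms show ?thesis by (force simp: psub_def)
qed

lemma psub_append_left:
  assumes "p \<in> pwords k l n" "length q = l"
  shows "psub k (q @ q') p = psub k q p"
proof -
  have "x < k + l" if "x \<in> set p" for x
    using assms pword_less[of k l p x] that by (auto simp: pwords_def)
  then show ?thesis using assms by (force simp: psub_def nth_append)
qed

section \<open>The Hales-Jewett theorem\<close>

text \<open>Colourings are total on lists, which avoids relativizing them to a cube. The dimension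
  \<open>l\<close> and the colour set are quantified inside, so \<open>ramsey k 0\<close> is the
  full multidimensional Hales-Jewett theorem for \<open>k\<close> letters and can be reused with
  larger colour sets.\<close>

definition ramsey :: "nat \<Rightarrow> nat \<Rightarrow> bool" where
  "ramsey k m \<longleftrightarrow> (\<forall>l S. finite S \<longrightarrow> (\<exists>n. \<forall>\<chi> :: nat list \<Rightarrow> nat. range \<chi> \<subseteq> S \<longrightarrow>
     (\<exists>p \<in> pwords k l n. \<exists>c. \<forall>q \<in> pwords k m l. \<chi> (psub k q p) = c)))"

text \<open>Coding the list of all values as one number merges finitely many colourings. This is how
  one block of coordinates is made uniform over all contents of another block.\<close>

lemma product_colouring:
  fixes S :: "nat set" and X :: "'x set"
  assumes "finite X" "finite S"
  shows "\<exists>S' :: nat set. finite S' \<and> (\<forall>\<chi> :: 'x \<Rightarrow> 'y \<Rightarrow> nat. (\<forall>x y. \<chi> x y \<in> S) \<longrightarrow>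
    (\<exists>\<chi>'. range \<chi>' \<subseteq> S' \<and> (\<forall>y z. \<chi>' y = \<chi>' z \<longrightarrow> (\<forall>x\<in>X. \<chi> x y = \<chi> x z))))"
proof -
  obtain xs where xs: "set xs = X" using finite_list[OF assms(1)] by blast
  let ?S' = "list_encode ` {cs. set cs \<subseteq> S \<and> length cs = length xs}"
  have "\<exists>\<chi>'. range \<chi>' \<subseteq> ?S' \<and> (\<forall>y z. \<chi>' y = \<chi>' z \<longrightarrow> (\<forall>x\<in>X. \<chi> x y = \<chi> x z))"
    if "\<forall>x y. \<chi> x y \<in> S" for \<chi> :: "'x \<Rightarrow> 'y \<Rightarrow> nat"
    using that xs by (intro exI[of _ "\<lambda>y. list_encode (map (\<lambda>x. \<chi> x y) xs)"])
      (auto simp: list_encode_eq intro!: imageI)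
  moreover have "finite ?S'"
    using assms by (intro finite_imageI finite_lists_length_eq)
  ultimately show ?thesis by blast
qed

text \<open>The extra letter \<open>k\<close> is substituted only, it does not occur in the parameter word: the colour of
  a word \<open>u k\<^sup>*\<close> with \<open>u\<close> over the first \<open>k\<close> letters depends only on the length of \<open>u\<close>.\<close>

lemma layered_subspace:
  assumes "ramsey k 0" "finite S"
  shows "\<exists>n. \<forall>\<chi> :: nat list \<Rightarrow> nat. range \<chi> \<subseteq> S \<longrightarrow>
    (\<exists>p \<in> pwords k t n. \<exists>f. \<forall>i\<le>t. \<forall>u \<in> pwords k 0 i. \<chi> (psub k (u @ replicate (t - i) k) p) = f i)"
proof (induction t)
  case 0
  show ?case
  proof (intro exI[of _ 0] allI impI bexI[of _ "[]"])
    fix \<chi> :: "nat list \<Rightarrow> nat"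
    show "\<exists>f. \<forall>i\<le>0. \<forall>u\<in>pwords k 0 i. \<chi> (psub k (u @ replicate (0 - i) k) []) = f i"
      by (auto simp: psub_def)
  qed (auto simp: pwords_def)
next
  case (Suc t)
  then obtain n1 where n1: "\<And>\<chi> :: nat list \<Rightarrow> nat. range \<chi> \<subseteq> S \<Longrightarrow>
    (\<exists>p \<in> pwords k t n1. \<exists>f. \<forall>i\<le>t. \<forall>u \<in> pwords k 0 i. \<chi> (psub k (u @ replicate (t - i) k) p) = f i)"
    by blast
  obtain n where n: "\<And>\<chi> :: nat list \<Rightarrow> nat. range \<chi> \<subseteq> S \<Longrightarrow>
     (\<exists>p \<in> pwords k (Suc n1) n. \<exists>c. \<forall>q \<in> pwords k 0 (Suc n1). \<chi> (psub k q p) = c)"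
    using assms unfolding ramsey_def by meson
  show ?case
  proof (intro exI[of _ n] allI impI)
    fix \<chi> :: "nat list \<Rightarrow> nat"
    assume \<chi>: "range \<chi> \<subseteq> S"
    from n[OF this] obtain p0 c where p0: "p0 \<in> pwords k (Suc n1) n"
      and c: "\<And>q. q \<in> pwords k 0 (Suc n1) \<Longrightarrow> \<chi> (psub k q p0) = c" by blast
    \<comment> \<open>Points over the first \<open>k\<close> letters are already monochromatic in
      \<open>p0\<close>. Every other level ends in \<open>k\<close>, so the induction hypothesis is
      applied with the last coordinate frozen at \<open>k\<close>.\<close>
    have "range (\<lambda>x. \<chi> (psub k (x @ [k]) p0)) \<subseteq> S" using \<chi> by blast
    from n1[OF this] obtain p1 f where p1: "p1 \<in> pwords k t n1"
      and f: "\<And>i u. i \<le> t \<Longrightarrow> u \<in> pwords k 0 i \<Longrightarrow> \<chi> (psub k (psub k (u @ replicate (t - i) k) p1 @ [k]) p0) = f i"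
      by blast
    let ?q = "p1 @ [k + t]"
    have q: "?q \<in> pwords k (Suc t) (Suc n1)"
      using p1 pword_append[of k t p1 1 "[k + t]"] by (auto simp: pwords_def)
    have sub: "psub k (v @ [a]) (psub k ?q p0) = psub k (psub k v p1 @ [a]) p0" if "length v = t" for v a
    proof -
      have "psub k (v @ [a]) (psub k ?q p0) = psub k (psub k (v @ [a]) ?q) p0"
        using psub_psub[OF p0] q by (simp add: pwords_def)
      also have "psub k (v @ [a]) ?q = psub k v p1 @ psub k (v @ [a]) [k + t]"
        using psub_append_left[OF p1 that] by simp
      also have "psub k (v @ [a]) [k + t] = [a]"
        using that by (simp add: psub_def nth_append)
      finally show ?thesis .
    qed
    show "\<exists>p \<in> pwords k (Suc t) n. \<exists>f. \<forall>i\<le>Suc t. \<forall>u \<in> pwords k 0 i.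
        \<chi> (psub k (u @ replicate (Suc t - i) k) p) = f i"
    proof (intro bexI exI allI impI ballI)
      show "psub k ?q p0 \<in> pwords k (Suc t) n" by (rule psub_in_pwords[OF p0 q]) simp
      fix i u assume i: "i \<le> Suc t" and u: "u \<in> pwords k 0 i"
      show "\<chi> (psub k (u @ replicate (Suc t - i) k) (psub k ?q p0)) = (if i \<le> t then f i else c)"
      proof (cases "i \<le> t")
        case True
        then have "u @ replicate (Suc t - i) k = (u @ replicate (t - i) k) @ [k]"
          by (simp add: Suc_diff_le replicate_append_same)
        moreover have "length (u @ replicate (t - i) k) = t" using True u by (simp add: pwords_def)
        ultimately show ?thesis using sub[of "u @ replicate (t - i) k" k] f[OF True u] True by simp
      next
        case False
        with i u have "length u = Suc t" by (simp add: pwords_def)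
        then obtain v a where v: "u = v @ [a]" by (metis append_butlast_last_id length_0_conv nat.simps(3))
        with \<open>length u = Suc t\<close> u have lv: "length v = t" and a: "a < k" "v \<in> pwords k 0 t" by (auto simp: pwords_def pword_0)
        have "psub k v p1 @ [a] \<in> pwords k 0 (Suc n1)"
          using psub_in_pwords[OF p1 a(2)] a by (auto simp: pwords_def pword_0)
        then show ?thesis using False i sub[OF lv] c v by simp
      qed
    qed
  qed
qed

lemma replicate_in_pwords: "0 < k \<Longrightarrow> replicate i 0 \<in> pwords k 0 i"
  by (simp add: pwords_def pword_0)

text \<open>Among the \<open>card S + 1\<close> levels of a layered subspace two,
  \<open>i < j\<close>, share a colour. The line is \<open>0\<close> on the first \<open>i\<close>
  coordinates, moves on the next \<open>j - i\<close> and is \<open>k\<close> afterwards: a letter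
  below \<open>k\<close> gives a point of level \<open>j\<close>, and the letter \<open>k\<close>
  gives one of level \<open>i\<close>.\<close>

lemma hales_jewett_line:
  assumes R: "ramsey k 0" and S: "finite S" and k: "0 < k"
  shows "\<exists>n. \<forall>\<chi> :: nat list \<Rightarrow> nat. range \<chi> \<subseteq> S \<longrightarrow>
    (\<exists>p \<in> pwords (Suc k) 1 n. \<forall>a<Suc k. \<chi> (psub (Suc k) [a] p) = \<chi> (psub (Suc k) [0] p))"
proof -
  let ?t = "card S"
  obtain n where n: "\<And>\<chi> :: nat list \<Rightarrow> nat. range \<chi> \<subseteq> S \<Longrightarrow>
    (\<exists>p \<in> pwords k ?t n. \<exists>f. \<forall>i\<le>?t. \<forall>u \<in> pwords k 0 i. \<chi> (psub k (u @ replicate (?t - i) k) p) = f i)"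
    using layered_subspace[OF R S, of ?t] by blast
  show ?thesis
  proof (intro exI[of _ n] allI impI)
    fix \<chi> :: "nat list \<Rightarrow> nat"
    assume \<chi>: "range \<chi> \<subseteq> S"
    from n[OF this] obtain p f where p: "p \<in> pwords k ?t n"
      and f: "\<And>i u. i \<le> ?t \<Longrightarrow> u \<in> pwords k 0 i \<Longrightarrow> \<chi> (psub k (u @ replicate (?t - i) k) p) = f i" by blast
    have "f i \<in> S" if "i \<le> ?t" for i
      using f[OF that replicate_in_pwords[OF k]] \<chi> by (metis rangeI subsetD)
    then have "f ` {..?t} \<subseteq> S" by auto
    with S have "card (f ` {..?t}) < card {..?t}"
      using card_mono[OF S] by (simp add: le_imp_less_Suc)
    then have "\<not> inj_on f {..?t}" using pigeonhole by blast
    then obtain i j where ij: "i < j" "j \<le> ?t" "f i = f j"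
      by (metis atMost_iff inj_on_def nat_neq_iff)
    \<comment> \<open>Over \<open>Suc k\<close> letters \<open>k\<close> is the new letter and
      \<open>Suc k\<close> is the parameter.\<close>
    let ?q = "replicate i 0 @ replicate (j - i) (Suc k) @ replicate (?t - j) k"
    have "pword (Suc k) 0 (replicate i 0)" by (simp add: pword_0)
    moreover have "pword (Suc k) 1 (replicate (j - i) (Suc k))"
      using ij by (cases "j - i") (auto simp: pword_0)
    moreover have "pword (Suc k + 1) 0 (replicate (?t - j) k)" by (simp add: pword_0)
    ultimately have "pword (Suc k) 1 ?q"
      using pword_append[of "Suc k" 1 "replicate (j - i) (Suc k)" 0 "replicate (?t - j) k"]
        pword_append[of "Suc k" 0 "replicate i 0" 1] by simp
    with ij have q: "?q \<in> pwords (Suc k) 1 ?t" by (simp add: pwords_def)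
    have line: "\<chi> (psub (Suc k) [a] (psub k ?q p)) = f j" if "a < Suc k" for a
    proof -
      have "psub (Suc k) [a] (psub k ?q p) = psub k (psub (Suc k) [a] ?q) p"
        by (rule psub_psub[OF p]) (use ij in simp_all)
      also have "psub (Suc k) [a] ?q = replicate i 0 @ replicate (j - i) a @ replicate (?t - j) k"
        by (simp add: psub_def)
      finally have *: "psub (Suc k) [a] (psub k ?q p) =
        psub k (replicate i 0 @ replicate (j - i) a @ replicate (?t - j) k) p" .
      show ?thesis
      proof (cases "a < k")
        case True
        then have "replicate i 0 @ replicate (j - i) a \<in> pwords k 0 j" using ij k by (auto simp: pwords_def pword_0)
        from f[OF ij(2) this] show ?thesis by (simp add: *)
      next
        case False
        with that have "a = k" by simp
        have "i \<le> ?t" using ij by simp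
        from f[OF this replicate_in_pwords[OF k]] ij show ?thesis
          unfolding * unfolding \<open>a = k\<close> by (simp add: replicate_add[symmetric])
      qed
    qed
    show "\<exists>p \<in> pwords (Suc k) 1 n. \<forall>a<Suc k. \<chi> (psub (Suc k) [a] p) = \<chi> (psub (Suc k) [0] p)"
    proof
      show "psub k ?q p \<in> pwords (Suc k) 1 n" by (rule psub_in_pwords[OF p q]) simp
    qed (simp add: line)
  qed
qed

text \<open>The last direction is a line in a second block of coordinates, chosen uniformly for all
  contents of the first block. The other directions come from the induction hypothesis in the first
  block, with the line frozen at its point for the letter \<open>0\<close>.\<close>

lemma ramsey_0_if_line:
  assumes line: "\<And>S. finite S \<Longrightarrow> \<exists>n. \<forall>\<chi> :: nat list \<Rightarrow> nat. range \<chi> \<subseteq> S \<longrightarrow>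
    (\<exists>p \<in> pwords k 1 n. \<forall>a<k. \<chi> (psub k [a] p) = \<chi> (psub k [0] p))"
  shows "ramsey k 0"
  unfolding ramsey_def
proof (intro allI impI)
  fix l and S :: "nat set"
  assume S: "finite S"
  show "\<exists>n. \<forall>\<chi>. range \<chi> \<subseteq> S \<longrightarrow> (\<exists>p\<in>pwords k l n. \<exists>c. \<forall>q\<in>pwords k 0 l. \<chi> (psub k q p) = c)"
  proof (induction l)
    case 0
    show ?case
      by (rule exI[of _ 0]) (auto simp: pwords_def psub_def)
  next
    case (Suc l)
    then obtain n1 where n1: "\<And>\<chi>. range \<chi> \<subseteq> S \<Longrightarrow> \<exists>p\<in>pwords k l n1. \<exists>c. \<forall>q\<in>pwords k 0 l. \<chi> (psub k q p) = c"
      by blast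
    from product_colouring[OF finite_pwords S, of k 0 n1] obtain S' :: "nat set" where "finite S' \<and>
      (\<forall>\<chi> :: nat list \<Rightarrow> nat list \<Rightarrow> nat. (\<forall>x y. \<chi> x y \<in> S) \<longrightarrow>
       (\<exists>\<chi>'. range \<chi>' \<subseteq> S' \<and> (\<forall>y z. \<chi>' y = \<chi>' z \<longrightarrow> (\<forall>x\<in>pwords k 0 n1. \<chi> x y = \<chi> x z))))"
      by (rule exE)
    note S' = conjunct1[OF this] conjunct2[OF this]
    from line[OF S'(1)] obtain n2 where "\<forall>\<chi> :: nat list \<Rightarrow> nat. range \<chi> \<subseteq> S' \<longrightarrow>
      (\<exists>p \<in> pwords k 1 n2. \<forall>a<k. \<chi> (psub k [a] p) = \<chi> (psub k [0] p))"
      by (rule exE)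
    note n2 = this[rule_format]
    show ?case
    proof (intro exI[of _ "n1 + n2"] allI impI)
      fix \<chi> :: "nat list \<Rightarrow> nat"
      assume \<chi>: "range \<chi> \<subseteq> S"
      have "\<forall>x y. \<chi> (x @ y) \<in> S" using \<chi> by auto
      from S'(2)[THEN spec[of _ "\<lambda>x y. \<chi> (x @ y)"], THEN mp, OF this]
      obtain \<chi>' where "range \<chi>' \<subseteq> S' \<and>
        (\<forall>y z. \<chi>' y = \<chi>' z \<longrightarrow> (\<forall>x\<in>pwords k 0 n1. \<chi> (x @ y) = \<chi> (x @ z)))"
        by (rule exE)
      note \<chi>' = conjunct1[OF this] conjunct2[OF this, rule_format]
      obtain p2 where p2: "p2 \<in> pwords k 1 n2" "\<And>a. a < k \<Longrightarrow> \<chi>' (psub k [a] p2) = \<chi>' (psub k [0] p2)"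
        using n2[OF \<chi>'(1)] by auto
      have "range (\<lambda>x. \<chi> (x @ psub k [0] p2)) \<subseteq> S" using \<chi> by blast
      from n1[OF this] obtain p1 c where p1: "p1 \<in> pwords k l n1"
        and c: "\<And>q. q \<in> pwords k 0 l \<Longrightarrow> \<chi> (psub k q p1 @ psub k [0] p2) = c" by blast
      let ?p = "p1 @ psub k [k + l] p2"
      have "psub k [k + l] p2 \<in> pwords (k + l) 1 n2"
        by (rule psub_in_pwords[OF p2(1)]) (auto simp: pwords_def)
      then have p: "?p \<in> pwords k (Suc l) (n1 + n2)"
        using p1 pword_append[of k l p1 1] by (auto simp: pwords_def)
      have "\<chi> (psub k q ?p) = c" if q: "q \<in> pwords k 0 (Suc l)" for q
      proof -
        obtain v a where v: "q = v @ [a]" using q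
          by (metis (mono_tags, lifting) pwords_def append_butlast_last_id length_0_conv mem_Collect_eq nat.simps(3))
        with q have a: "a < k" "v \<in> pwords k 0 l" "length v = l" by (auto simp: pwords_def pword_0)
        have "psub k q (psub k [k + l] p2) = psub k (psub k q [k + l]) p2"
          by (rule psub_psub[OF p2(1)]) auto
        also have "psub k q [k + l] = [a]" using v a by (simp add: psub_def nth_append)
        finally have "psub k q ?p = psub k v p1 @ psub k [a] p2"
          using psub_append_left[OF p1 a(3)] v by simp
        moreover have "psub k v p1 \<in> pwords k 0 n1" by (rule psub_in_pwords[OF p1 a(2)]) simp
        ultimately show ?thesis using \<chi>'(2)[OF p2(2)[OF a(1)]] c[OF a(2)] by simp
      qed
      with p show "\<exists>p\<in>pwords k (Suc l) (n1 + n2). \<exists>c. \<forall>q\<in>pwords k 0 (Suc l). \<chi> (psub k q p) = c"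
        by blast
    qed
  qed
qed

lemma hales_jewett: "ramsey (Suc k) 0"
proof (induction k)
  case 0
  show ?case
    by (rule ramsey_0_if_line, rule exI[of _ 1], auto simp: pwords_def intro!: exI[of _ "[Suc 0]"])
next
  case (Suc k)
  show ?case by (rule ramsey_0_if_line, rule hales_jewett_line[OF Suc]) auto
qed

section \<open>From Hales-Jewett to Graham-Rothschild\<close>

text \<open>The dimension grows at the front. A parameter in the first coordinate acts as a further
  letter for the rest, so the Ramsey property over \<open>Suc k\<close> letters gives one colour to
  all words that begin with a parameter. Words that begin with a letter are left to the induction
  hypothesis, applied to the colouring that records the colours for all \<open>k\<close> possible
  first letters.\<close>

lemma tail_independent_subspace:
  assumes R: "ramsey (Suc k) m" and S: "finite S"
  shows "\<exists>n. \<forall>c :: nat list \<Rightarrow> nat. range c \<subseteq> S \<longrightarrow>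
    (\<exists>p \<in> pwords k L n. \<forall>q \<in> pwords k (Suc m) L. \<forall>q' \<in> pwords k (Suc m) L.
       takeWhile (\<lambda>x. x < k) q = takeWhile (\<lambda>x. x < k) q' \<longrightarrow> c (psub k q p) = c (psub k q' p))"
  using S
proof (induction L arbitrary: S)
  case 0
  show ?case
    by (rule exI[of _ 0]) (auto simp: pwords_def)
next
  case (Suc L)
  from product_colouring[OF finite_lessThan Suc.prems, of k] obtain S' :: "nat set" where "finite S' \<and>
      (\<forall>\<chi> :: nat \<Rightarrow> nat list \<Rightarrow> nat. (\<forall>x y. \<chi> x y \<in> S) \<longrightarrow>
       (\<exists>\<chi>'. range \<chi>' \<subseteq> S' \<and> (\<forall>y z. \<chi>' y = \<chi>' z \<longrightarrow> (\<forall>x\<in>{..<k}. \<chi> x y = \<chi> x z))))"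
      by (rule exE)
  note S' = conjunct1[OF this] conjunct2[OF this]
  obtain n1 where n1: "\<And>c :: nat list \<Rightarrow> nat. range c \<subseteq> S' \<Longrightarrow>
    (\<exists>p \<in> pwords k L n1. \<forall>q \<in> pwords k (Suc m) L. \<forall>q' \<in> pwords k (Suc m) L.
       takeWhile (\<lambda>x. x < k) q = takeWhile (\<lambda>x. x < k) q' \<longrightarrow> c (psub k q p) = c (psub k q' p))"
    using Suc.IH[OF S'(1)] by blast
  obtain n2 where n2: "\<And>\<chi> :: nat list \<Rightarrow> nat. range \<chi> \<subseteq> S \<Longrightarrow>
     (\<exists>p \<in> pwords (Suc k) n1 n2. \<exists>c. \<forall>q \<in> pwords (Suc k) m n1. \<chi> (psub (Suc k) q p) = c)"
    using R Suc.prems unfolding ramsey_def by meson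
  show ?case
  proof (intro exI[of _ "Suc n2"] allI impI)
    fix c :: "nat list \<Rightarrow> nat"
    assume c: "range c \<subseteq> S"
    then have "range (\<lambda>v. c (k # v)) \<subseteq> S" by blast
    from n2[OF this] obtain p1 c0 where p1: "p1 \<in> pwords (Suc k) n1 n2"
      and c0: "\<And>q. q \<in> pwords (Suc k) m n1 \<Longrightarrow> c (k # psub (Suc k) q p1) = c0" by blast
    let ?p0 = "k # p1"
    have p0: "?p0 \<in> pwords k (Suc n1) (Suc n2)" using p1 by (auto simp: pwords_def)
    have "\<forall>x y. c (psub k (x # y) ?p0) \<in> S" using c by auto
    from S'(2)[THEN spec[of _ "\<lambda>x y. c (psub k (x # y) ?p0)"], THEN mp, OF this]
    obtain c' where "range c' \<subseteq> S' \<and>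
      (\<forall>y z. c' y = c' z \<longrightarrow> (\<forall>x\<in>{..<k}. c (psub k (x # y) ?p0) = c (psub k (x # z) ?p0)))"
      by (rule exE)
    note c' = conjunct1[OF this] conjunct2[OF this, rule_format]
    obtain p2 where p2: "p2 \<in> pwords k L n1" and "\<And>q q'. q \<in> pwords k (Suc m) L \<Longrightarrow> q' \<in> pwords k (Suc m) L \<Longrightarrow>
       takeWhile (\<lambda>x. x < k) q = takeWhile (\<lambda>x. x < k) q' \<Longrightarrow> c' (psub k q p2) = c' (psub k q' p2)"
      using n1[OF c'(1)] by meson
    note tail = this(2)
    \<comment> \<open>\<open>?s\<close> is \<open>p2\<close> with its parameters renumbered from
      \<open>k + 1\<close>, since \<open>k\<close> now belongs to the first coordinate.\<close>
    let ?s = "psub k [Suc k..<Suc k + L] p2"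
    let ?r = "k # ?s"
    have s: "?s \<in> pwords (Suc k) L n1"
      by (rule psub_in_pwords[OF p2]) (use pword_upt[of "Suc k" L] in \<open>simp_all add: pwords_def\<close>)
    then have r: "?r \<in> pwords k (Suc L) (Suc n1)" by (simp add: pwords_def)
    have sub: "psub k (a # v) (psub k ?r ?p0) = psub k (a # psub k v p2) ?p0" if "length v = L" for a v
    proof -
      have "psub k (a # v) ?s = psub k (psub k (a # v) [Suc k..<Suc k + L]) p2"
        by (rule psub_psub[OF p2]) simp_all
      also have "psub k (a # v) [Suc k..<Suc k + L] = v"
      proof (rule nth_equalityI)
        fix i assume "i < length (psub k (a # v) [Suc k..<Suc k + L])"
        then have "[Suc k..<Suc k + L] ! i = Suc k + i" "i < L" by (simp_all del: upt_Suc)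
        then show "psub k (a # v) [Suc k..<Suc k + L] ! i = v ! i"
          by (simp add: psub_def Suc_diff_le del: upt_Suc)
      qed (simp add: that del: upt_Suc)
      finally have "psub k (a # v) ?r = a # psub k v p2" by (simp add: psub_def)
      moreover have "psub k (a # v) (psub k ?r ?p0) = psub k (psub k (a # v) ?r) ?p0"
        by (rule psub_psub[OF p0]) (use r in \<open>simp_all add: pwords_def\<close>)
      ultimately show ?thesis by simp
    qed
    show "\<exists>p \<in> pwords k (Suc L) (Suc n2). \<forall>q \<in> pwords k (Suc m) (Suc L). \<forall>q' \<in> pwords k (Suc m) (Suc L).
       takeWhile (\<lambda>x. x < k) q = takeWhile (\<lambda>x. x < k) q' \<longrightarrow> c (psub k q p) = c (psub k q' p)"
    proof (intro bexI ballI impI)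
      show "psub k ?r ?p0 \<in> pwords k (Suc L) (Suc n2)" by (rule psub_in_pwords[OF p0 r]) simp
      fix q q' assume q: "q \<in> pwords k (Suc m) (Suc L)" and q': "q' \<in> pwords k (Suc m) (Suc L)"
        and tw: "takeWhile (\<lambda>x. x < k) q = takeWhile (\<lambda>x. x < k) q'"
      obtain a v where v: "q = a # v" "length v = L" using q by (cases q) (auto simp: pwords_def)
      obtain a' v' where v': "q' = a' # v'" "length v' = L" using q' by (cases q') (auto simp: pwords_def)
      have front: "c (psub k (psub k (k # w) (?r)) ?p0) = c0" if w: "w \<in> pwords (Suc k) m L" for w
      proof -
        have lw: "length w = L" using w by (simp add: pwords_def)
        have *: "psub k w p2 \<in> pwords (Suc k) m n1" by (rule psub_in_pwords[OF p2 w]) simp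
        have "psub k (k # y) p1 = psub (Suc k) y p1" for y
          by (auto simp: psub_def nth_Cons' not_less_less_Suc_eq)
        then have "psub k (k # psub k w p2) ?p0 = k # psub (Suc k) (psub k w p2) p1"
          by (simp add: psub_def)
        moreover have "psub k (psub k (k # w) ?r) ?p0 = psub k (k # psub k w p2) ?p0"
          unfolding sub[OF lw, symmetric]
          by (rule psub_psub[OF p0, symmetric]) (use r in \<open>simp_all add: pwords_def\<close>)
        ultimately show ?thesis using c0[OF *] by simp
      qed
      have pp: "psub k x (psub k ?r ?p0) = psub k (psub k x ?r) ?p0" for x
        by (rule psub_psub[OF p0]) (use r in \<open>simp_all add: pwords_def\<close>)
      show "c (psub k q (psub k ?r ?p0)) = c (psub k q' (psub k ?r ?p0))"
      proof (cases "a < k")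
        case True
        with tw v v' have a': "a' = a" "takeWhile (\<lambda>x. x < k) v = takeWhile (\<lambda>x. x < k) v'"
          by (auto split: if_splits)
        have "v \<in> pwords k (Suc m) L" "v' \<in> pwords k (Suc m) L"
          using q q' v v' True a' by (auto simp: pwords_def)
        from c'(2)[OF tail[OF this a'(2)]] True show ?thesis
          unfolding v(1) v'(1) a'(1) sub[OF v(2)] sub[OF v'(2)] by simp
      next
        case False
        with tw v v' have "\<not> a' < k" by (auto split: if_splits)
        with False q q' v v' have "a = k" "a' = k" "v \<in> pwords (Suc k) m L" "v' \<in> pwords (Suc k) m L"
          by (auto simp: pwords_def)
        then show ?thesis using front v v' by (simp only: pp)
      qed
    qed
  qed
qed

text \<open>In a canonical word no parameter above \<open>k + i\<close> precedes the first
  \<open>k + i\<close>, and there both images cease to be letters at the latest. So the two maps can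
  differ only behind the initial segment that is read. In the induction \<open>j\<close> counts the
  parameters already passed.\<close>

lemma takeWhile_psub_cong:
  assumes "pword (k + j) l p" "j \<le> i" "\<And>x. x < k + i \<Longrightarrow> g x = h x" "k \<le> g (k + i)" "k \<le> h (k + i)"
  shows "takeWhile (\<lambda>x. x < k) (map g p) = takeWhile (\<lambda>x. x < k) (map h p)"
  using assms
proof (induction p arbitrary: j l)
  case (Cons x p)
  show ?case
  proof (cases "x < k + i")
    case True
    have "\<exists>j l. pword (k + j) l p \<and> j \<le> i"
    proof (cases "x < k + j")
      case True
      with Cons.prems show ?thesis by auto
    next
      case False
      with Cons.prems have "x = k + j" "pword (k + Suc j) (l - 1) p" by auto
      with \<open>x < k + i\<close> show ?thesis using less_imp_Suc_add by (intro exI[of _ "Suc j"] exI[of _ "l - 1"]) simp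
    qed
    with Cons.IH Cons.prems True show ?thesis by auto
  next
    case False
    with Cons.prems have "x = k + i" by auto
    with Cons.prems show ?thesis by auto
  qed
qed simp

text \<open>The \<open>l\<close> parameters go to the positions of \<open>I\<close> in increasing
  order, one each. Hence a parameter in any word substituted into \<open>r\<close> must come to
  stand at a position of \<open>I\<close>.\<close>

lemma select_coordinates:
  assumes "0 < k" "I \<subseteq> {..<t}" "card I = l"
  shows "\<exists>r \<in> pwords k l t. \<forall>j<t. j \<notin> I \<longrightarrow> r ! j = 0"
  using assms(2,3)
proof (induction t arbitrary: I l)
  case 0
  then show ?case by (auto simp: pwords_def)
next
  case (Suc t)
  have fin: "finite I" using Suc.prems finite_subset by blast
  have "I - {t} \<subseteq> {..<t}" using Suc.prems by (auto simp: less_Suc_eq)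
  from Suc.IH[OF this refl] obtain r where r: "r \<in> pwords k (card (I - {t})) t"
    and "\<forall>j<t. j \<notin> I - {t} \<longrightarrow> r ! j = 0" by blast
  then have r0: "r ! j = 0" if "j < t" "j \<notin> I" for j using that by simp
  show ?case
  proof (cases "t \<in> I")
    case True
    with Suc.prems fin have l: "l = card (I - {t}) + 1"
      using card_Suc_Diff1[of I t] by simp
    have "pword k l (r @ [k + card (I - {t})])"
      unfolding l by (rule pword_append) (use r in \<open>auto simp: pwords_def\<close>)
    with r r0 True show ?thesis
      by (intro bexI[of _ "r @ [k + card (I - {t})]"]) (auto simp: pwords_def nth_append less_Suc_eq)
  next
    case False
    with Suc.prems fin have l: "l = card (I - {t}) + 0" by simp
    have "pword k l (r @ [0])"
      unfolding l by (rule pword_append) (use r assms(1) in \<open>auto simp: pwords_def\<close>)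
    with r r0 False show ?thesis
      by (intro bexI[of _ "r @ [0]"]) (auto simp: pwords_def nth_append less_Suc_eq)
  qed
qed

lemma monochromatic_subset:
  fixes f :: "nat \<Rightarrow> nat"
  assumes "finite S" "\<And>i. i < card S * l + 1 \<Longrightarrow> f i \<in> S"
  obtains I c where "I \<subseteq> {..<card S * l + 1}" "card I = l" "\<And>i. i \<in> I \<Longrightarrow> f i = c"
proof -
  let ?t = "card S * l + 1"
  have "\<exists>c. l < card {i \<in> {..<?t}. f i = c}"
  proof (rule ccontr)
    assume "\<not> ?thesis"
    then have le: "card {i \<in> {..<?t}. f i = c} \<le> l" for c by (simp add: not_less)
    have "{..<?t} = (\<Union>c\<in>S. {i \<in> {..<?t}. f i = c})" using assms(2) by blast
    then have "?t = card (\<Union>c\<in>S. {i \<in> {..<?t}. f i = c})" by (metis card_lessThan)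
    also have "\<dots> \<le> (\<Sum>c\<in>S. card {i \<in> {..<?t}. f i = c})" by (rule card_UN_le[OF assms(1)])
    also have "\<dots> \<le> (\<Sum>c\<in>S. l)" by (rule sum_mono) (rule le)
    finally show False by simp
  qed
  then obtain c where c: "l \<le> card {i \<in> {..<?t}. f i = c}" using less_imp_le by blast
  obtain I where "I \<subseteq> {i \<in> {..<?t}. f i = c}" "card I = l"
    using obtain_subset_with_card_n[OF c] by metis
  with that[of I c] show ?thesis by blast
qed

text \<open>Tail independence leaves only the letters in front of the first parameter; layering then
  leaves only the position of that parameter, with colour \<open>f i\<close>. By the pigeonhole
  principle \<open>l\<close> positions share a colour, and a subspace that moves only there is
  monochromatic.\<close>

lemma ramsey_Suc:
  assumes R: "ramsey (Suc k) m" and HJ: "ramsey k 0" and k: "0 < k"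
  shows "ramsey k (Suc m)"
  unfolding ramsey_def
proof (intro allI impI)
  fix l and S :: "nat set"
  assume S: "finite S"
  define t where "t = card S * l + 1"
  obtain L where L: "\<And>\<chi> :: nat list \<Rightarrow> nat. range \<chi> \<subseteq> S \<Longrightarrow>
    (\<exists>p \<in> pwords k t L. \<exists>f. \<forall>i\<le>t. \<forall>u \<in> pwords k 0 i. \<chi> (psub k (u @ replicate (t - i) k) p) = f i)"
    using layered_subspace[OF HJ S] by blast
  obtain n where n: "\<And>c :: nat list \<Rightarrow> nat. range c \<subseteq> S \<Longrightarrow>
    (\<exists>p \<in> pwords k L n. \<forall>q \<in> pwords k (Suc m) L. \<forall>q' \<in> pwords k (Suc m) L.
       takeWhile (\<lambda>x. x < k) q = takeWhile (\<lambda>x. x < k) q' \<longrightarrow> c (psub k q p) = c (psub k q' p))"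
    using tail_independent_subspace[OF R S] by blast
  show "\<exists>n. \<forall>\<chi>. range \<chi> \<subseteq> S \<longrightarrow> (\<exists>p\<in>pwords k l n. \<exists>c. \<forall>q\<in>pwords k (Suc m) l. \<chi> (psub k q p) = c)"
  proof (intro exI[of _ n] allI impI)
    fix c :: "nat list \<Rightarrow> nat"
    assume c: "range c \<subseteq> S"
    from n[OF c] obtain p where p: "p \<in> pwords k L n"
      and tail: "\<And>q q'. q \<in> pwords k (Suc m) L \<Longrightarrow> q' \<in> pwords k (Suc m) L \<Longrightarrow>
       takeWhile (\<lambda>x. x < k) q = takeWhile (\<lambda>x. x < k) q' \<Longrightarrow> c (psub k q p) = c (psub k q' p)" by meson
    define g where "g u = c (psub k (SOME q. q \<in> pwords k (Suc m) L \<and> takeWhile (\<lambda>x. x < k) q = u) p)" for u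
    have g: "c (psub k q p) = g (takeWhile (\<lambda>x. x < k) q)" if "q \<in> pwords k (Suc m) L" for q
    proof -
      let ?P = "\<lambda>q'. q' \<in> pwords k (Suc m) L \<and> takeWhile (\<lambda>x. x < k) q' = takeWhile (\<lambda>x. x < k) q"
      have "?P (SOME q'. ?P q')" by (rule someI[of ?P q]) (use that in simp)
      then show ?thesis unfolding g_def using tail[OF that] by metis
    qed
    have gS: "g u \<in> S" for u using c unfolding g_def by blast
    \<comment> \<open>The extra letter \<open>k\<close> of the layered subspace marks the first parameter, so layering makes the
      colour independent of the letters in front of it.\<close>
    then have "range (\<lambda>x. g (takeWhile (\<lambda>x. x < k) x)) \<subseteq> S" by blast
    from L[OF this] obtain p1 f where p1: "p1 \<in> pwords k t L" and f: "\<And>i u. i \<le> t \<Longrightarrow> u \<in> pwords k 0 i \<Longrightarrow>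
      g (takeWhile (\<lambda>x. x < k) (psub k (u @ replicate (t - i) k) p1)) = f i" by blast
    have "f i \<in> S" if "i \<le> t" for i
      using f[OF that replicate_in_pwords[OF k]] gS by metis
    then have "f i \<in> S" if "i < card S * l + 1" for i using that by (simp add: t_def)
    from monochromatic_subset[of S l f, OF S this] obtain I c0
      where I: "I \<subseteq> {..<t}" "card I = l" "\<And>i. i \<in> I \<Longrightarrow> f i = c0"
      unfolding t_def by blast
    obtain r where r: "r \<in> pwords k l t" "\<And>j. j < t \<Longrightarrow> j \<notin> I \<Longrightarrow> r ! j = 0"
      using select_coordinates[OF k I(1,2)] by blast
    have lens: "length r = t" "length p1 = L" using r p1 by (simp_all add: pwords_def)
    let ?p = "psub k (psub k r p1) p"
    have rp1: "psub k r p1 \<in> pwords k l L" by (rule psub_in_pwords[OF p1 r(1)]) simp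
    have "c (psub k q ?p) = c0" if q: "q \<in> pwords k (Suc m) l" for q
    proof -
      let ?q = "psub k q r"
      define u where "u = takeWhile (\<lambda>x. x < k) ?q"
      define i where "i = length u"
      have q': "?q \<in> pwords k (Suc m) t" by (rule psub_in_pwords[OF r(1) q]) simp
      \<comment> \<open>There is a parameter to stop at: a word determines its number of parameters,
        and \<open>Suc m\<close> is not \<open>0\<close>.\<close>
      have "u \<noteq> ?q"
      proof
        assume "u = ?q"
        then have "\<forall>x\<in>set ?q. x < k" unfolding u_def by (metis set_takeWhileD)
        then have "pword k 0 ?q" by (simp add: pword_0)
        moreover have "pword k m p \<Longrightarrow> pword k m' p \<Longrightarrow> m = m'" for k m m' p
          by (induction p arbitrary: k m m') fastforce+
        ultimately show False using q' by (fastforce simp: pwords_def)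
      qed
      then have it: "i < length ?q"
        unfolding i_def u_def by (metis takeWhile_eq_take length_takeWhile_le order_le_imp_less_or_eq take_all_iff nless_le)
      then have i: "i < t" "\<not> ?q ! i < k"
        using lens nth_length_takeWhile[of "\<lambda>x. x < k" ?q] by (auto simp: i_def u_def)
      have "r ! i \<noteq> 0"
      proof
        assume "r ! i = 0"
        with i k lens show False by (simp add: psub_def)
      qed
      with r(2)[OF i(1)] have "i \<in> I" by metis
      have "\<forall>x\<in>set u. x < k" unfolding u_def by (metis set_takeWhileD)
      then have "u \<in> pwords k 0 i" by (simp add: i_def pwords_def pword_0)
      have nth: "?q ! j = u ! j" if "j < i" for j
        using that unfolding i_def u_def by (simp add: takeWhile_nth)
      \<comment> \<open>Replacing everything in \<open>?q\<close> from position \<open>i\<close> on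
        by \<open>k\<close> keeps the entries before \<open>i\<close> and a non-letter at
        \<open>i\<close>; the result has the form for which layering speaks.\<close>
      have "takeWhile (\<lambda>x. x < k) (psub k ?q p1) = takeWhile (\<lambda>x. x < k) (psub k (u @ replicate (t - i) k) p1)"
        unfolding psub_def[of k _ p1]
        by (rule takeWhile_psub_cong[of k 0 t _ i])
           (use p1 i nth in \<open>auto simp: pwords_def nth_append i_def[symmetric]\<close>)
      then have "g (takeWhile (\<lambda>x. x < k) (psub k ?q p1)) = f i"
        using f[OF _ \<open>u \<in> pwords k 0 i\<close>] i by simp
      moreover have "psub k ?q p1 \<in> pwords k (Suc m) L" by (rule psub_in_pwords[OF p1 q']) simp
      ultimately have "c (psub k (psub k ?q p1) p) = c0" using g I(3)[OF \<open>i \<in> I\<close>] by simp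
      moreover have "psub k q ?p = psub k (psub k q (psub k r p1)) p"
        by (rule psub_psub[OF p]) (use lens in simp_all)
      moreover have "psub k q (psub k r p1) = psub k ?q p1"
        by (rule psub_psub[OF p1]) (use lens in simp_all)
      ultimately show ?thesis by simp
    qed
    moreover have "?p \<in> pwords k l n" by (rule psub_in_pwords[OF p rp1]) simp
    ultimately show "\<exists>p\<in>pwords k l n. \<exists>c'. \<forall>q\<in>pwords k (Suc m) l. c (psub k q p) = c'" by blast
  qed
qed

theorem graham_rothschild: "ramsey (Suc k) m"
proof (induction m arbitrary: k)
  case 0
  show ?case by (rule hales_jewett)
next
  case (Suc m)
  show ?case by (rule ramsey_Suc[OF Suc hales_jewett]) simp
qed

section \<open>Homogeneous orders\<close>

text \<open>The first argument collects the types already met. Started at \<open>{}\<close>, the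
  result is all the information about a pair of words that survives in a homogeneous
  subspace.\<close>

fun column_types :: "('a \<times> 'a) set \<Rightarrow> ('a \<times> 'a) list \<Rightarrow> ('a \<times> 'a) list" where
  "column_types X [] = []"
| "column_types X (z # zs) =
    (if fst z = snd z \<or> z \<in> X then column_types X zs else z # column_types (insert z X) zs)"

lemma column_types_diag:
  "\<forall>z\<in>set xs. fst z = snd z \<Longrightarrow> column_types X (xs @ ys) = column_types X ys"
  by (induction xs) auto

lemma column_types_append_diag:
  "fst z = snd z \<Longrightarrow> column_types X (xs @ z # ys) = column_types X (xs @ ys)"
  by (induction xs arbitrary: X) auto

lemma column_types_dup:
  "column_types X (xs @ z # z # ys) = column_types X (xs @ z # ys)"
  by (induction xs arbitrary: X) auto

lemma column_types_zip_same: "column_types X (zip xs xs @ ys) = column_types X ys"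
  by (rule column_types_diag) (auto simp: zip_same_conv_map)

text \<open>Homogeneity links pairs of words of different lengths, so columns can be inserted and
  dropped within the bound \<open>M\<close>. Three columns suffice for the cycles below.\<close>

locale homogeneous_order =
  fixes A :: "'a set" and M :: nat and P :: "'a list \<Rightarrow> 'a list \<Rightarrow> bool"
  assumes fin: "finite A"
    and M3: "3 \<le> M"
    and irrefl: "\<And>w. \<not> P w w"
    and trans: "\<And>u v w. P u v \<Longrightarrow> P v w \<Longrightarrow> P u w"
    and total: "\<And>v w. length v = length w \<Longrightarrow> length v \<le> M \<Longrightarrow> set v \<subseteq> A \<Longrightarrow> set w \<subseteq> A
      \<Longrightarrow> v \<noteq> w \<Longrightarrow> P v w \<or> P w v"
    and homogeneous: "\<And>zs zs'. length zs \<le> M \<Longrightarrow> length zs' \<le> M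
      \<Longrightarrow> set zs \<subseteq> A \<times> A \<Longrightarrow> set zs' \<subseteq> A \<times> A
      \<Longrightarrow> column_types {} zs = column_types {} zs'
      \<Longrightarrow> P (map fst zs) (map snd zs) \<Longrightarrow> P (map fst zs') (map snd zs')"
begin

section \<open>The order of the letters and the weights of intervals\<close>

definition less :: "'a \<Rightarrow> 'a \<Rightarrow> bool" where
  "less a b \<longleftrightarrow> a \<in> A \<and> b \<in> A \<and> P [a] [b]"

lemma homog:
  assumes "P v v'" "length v = length v'" "length w = length w'" "length v \<le> M" "length w \<le> M"
    "set v \<subseteq> A" "set v' \<subseteq> A" "set w \<subseteq> A" "set w' \<subseteq> A"
    "column_types {} (zip v v') = column_types {} (zip w w')"
  shows "P w w'"
proof -
  have "set (zip v v') \<subseteq> A \<times> A" "set (zip w w') \<subseteq> A \<times> A"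
    using assms by (auto dest: set_zip_leftD set_zip_rightD)
  with homogeneous[of "zip v v'" "zip w w'"] assms show ?thesis by simp
qed

lemma asym: "P v w \<Longrightarrow> \<not> P w v"
  using irrefl trans by blast

lemma less_in: "less a b \<Longrightarrow> a \<in> A" "less a b \<Longrightarrow> b \<in> A"
  by (auto simp: less_def)

lemma less_trans: "less a b \<Longrightarrow> less b c \<Longrightarrow> less a c"
  unfolding less_def using trans by blast

lemma less_irrefl: "\<not> less a a"
  unfolding less_def using irrefl by blast

lemma less_asym: "less a b \<Longrightarrow> \<not> less b a"
  using less_irrefl less_trans by blast

lemma less_neq: "less a b \<Longrightarrow> a \<noteq> b"
  using less_irrefl by blast

lemma less_total: "a \<in> A \<Longrightarrow> b \<in> A \<Longrightarrow> a \<noteq> b \<Longrightarrow> less a b \<or> less b a"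
  unfolding less_def using total[of "[a]" "[b]"] M3 by simp

text \<open>An interval in an earlier column that goes up outweighs an interval in a later column that
  goes down.\<close>
definition outweighs :: "'a \<times> 'a \<Rightarrow> 'a \<times> 'a \<Rightarrow> bool" where
  "outweighs I J \<longleftrightarrow> P [fst I, snd J] [snd I, fst J]"

definition intervals :: "('a \<times> 'a) set" where
  "intervals = {(a, b). less a b}"

lemma finite_intervals: "finite intervals"
  by (rule finite_subset[of _ "A \<times> A"]) (auto simp: intervals_def less_def fin)

text \<open>If both fail, totality reverses both comparisons and \<open>[b, c, b]\<close>,
  \<open>[a, d, a]\<close>, \<open>[a, c, b]\<close> form a cycle: its steps have the column types
  of the first reversed comparison, of the second, and of \<open>a\<close> below
  \<open>b\<close>.\<close>

lemma outweighs_total: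
  assumes "less a b" "less c d"
  shows "outweighs (a, b) (c, d) \<or> outweighs (c, d) (a, b)"
proof (rule ccontr)
  assume "\<not> ?thesis"
  then have n: "\<not> P [a, d] [b, c]" "\<not> P [c, b] [d, a]" by (auto simp: outweighs_def)
  have A: "a \<in> A" "b \<in> A" "c \<in> A" "d \<in> A" and neq: "a \<noteq> b" "c \<noteq> d"
    using assms less_in less_neq by blast+
  have ab: "P [a] [b]" using assms by (simp add: less_def)
  have 1: "P [b, c] [a, d]" and 2: "P [d, a] [c, b]"
    using n total[of "[a, d]" "[b, c]"] total[of "[c, b]" "[d, a]"] A neq M3 by auto
  have "P [b, c, b] [a, d, a]" by (rule homog[OF 1]) (use A neq M3 in auto)
  moreover have "P [a, d, a] [a, c, b]" by (rule homog[OF 2]) (use A neq M3 in auto)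
  moreover have "P [a, c, b] [b, c, b]" by (rule homog[OF ab]) (use A neq M3 in auto)
  ultimately show False using trans irrefl by blast
qed

text \<open>The middle interval cancels: \<open>[a, d, f]\<close> is below \<open>[b, c, f]\<close>,
  which is below \<open>[b, d, e]\<close>, and the column with \<open>d\<close> at both ends is
  invisible.\<close>

lemma outweighs_trans:
  assumes "less a b" "less c d" "less e f"
    and "outweighs (a, b) (c, d)" "outweighs (c, d) (e, f)"
  shows "outweighs (a, b) (e, f)"
proof -
  have A: "a \<in> A" "b \<in> A" "c \<in> A" "d \<in> A" "e \<in> A" "f \<in> A" and neq: "a \<noteq> b" "c \<noteq> d" "e \<noteq> f"
    using assms less_in less_neq by blast+
  have 1: "P [a, d] [b, c]" and 2: "P [c, f] [d, e]" using assms by (simp_all add: outweighs_def)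
  have "P [a, d, f] [b, c, f]" by (rule homog[OF 1]) (use A neq M3 in auto)
  moreover have "P [b, c, f] [b, d, e]" by (rule homog[OF 2]) (use A neq M3 in auto)
  ultimately have 3: "P [a, d, f] [b, d, e]" by (rule trans)
  show ?thesis unfolding outweighs_def by (rule homog[OF 3]) (use A neq M3 in auto)
qed

text \<open>Every interval outweighs itself, so \<open>[a, b]\<close> is below
  \<open>[b, a]\<close>, and raising \<open>b\<close> to \<open>c\<close> leads to
  \<open>[c, a]\<close>. Likewise \<open>[a, c]\<close> is below \<open>[b, c]\<close>, which is
  below \<open>[c, b]\<close>.\<close>

lemma outweighs_subinterval:
  assumes "less a b" "less b c"
  shows "outweighs (a, c) (a, b)" "outweighs (a, c) (b, c)"
proof -
  have ac: "less a c" using assms less_trans by blast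
  have A: "a \<in> A" "b \<in> A" "c \<in> A" and neq: "a \<noteq> b" "b \<noteq> c" "a \<noteq> c"
    using assms ac less_in less_neq by blast+
  have 1: "P [a, b] [b, a]" "P [b, c] [c, b]"
    using outweighs_total[of a b a b] outweighs_total[of b c b c] assms by (simp_all add: outweighs_def)
  have 2: "P [a] [b]" "P [b] [c]" using assms by (simp_all add: less_def)
  have "P [b, a] [c, a]" by (rule homog[OF 2(2)]) (use A neq M3 in auto)
  with 1 show "outweighs (a, c) (a, b)" using trans by (auto simp: outweighs_def)
  have "P [a, c] [b, c]" by (rule homog[OF 2(1)]) (use A neq M3 in auto)
  with 1 show "outweighs (a, c) (b, c)" using trans by (auto simp: outweighs_def)
qed

text \<open>This makes the weight of an interval a maximum and not just monotone. Otherwise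
  \<open>[c, a, a]\<close>, \<open>[b, c, a]\<close>, \<open>[a, c, c]\<close> form a cycle; its
  last step is \<open>[a, c]\<close> below \<open>[c, a]\<close> with the second column
  duplicated.\<close>

lemma subinterval_outweighs:
  assumes "less a b" "less b c"
  shows "outweighs (a, b) (a, c) \<or> outweighs (b, c) (a, c)"
proof (rule ccontr)
  assume "\<not> ?thesis"
  then have n: "\<not> P [a, c] [b, a]" "\<not> P [b, c] [c, a]" by (auto simp: outweighs_def)
  have ac: "less a c" using assms less_trans by blast
  have A: "a \<in> A" "b \<in> A" "c \<in> A" and neq: "a \<noteq> b" "b \<noteq> c" "a \<noteq> c"
    using assms ac less_in less_neq by blast+
  have 1: "P [b, a] [a, c]" and 2: "P [c, a] [b, c]"
    using n total[of "[a, c]" "[b, a]"] total[of "[b, c]" "[c, a]"] A neq M3 by auto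
  have 3: "P [a, c] [c, a]" using outweighs_total[of a c a c] ac by (simp add: outweighs_def)
  have "P [c, a, a] [b, c, a]" by (rule homog[OF 2]) (use A neq M3 in auto)
  moreover have "P [b, c, a] [a, c, c]" by (rule homog[OF 1]) (use A neq M3 in auto)
  moreover have "P [a, c, c] [c, a, a]" by (rule homog[OF 3]) (use A neq M3 in auto)
  ultimately show False using trans irrefl by blast
qed

text \<open>The rank of an interval in the total preorder \<open>outweighs\<close>. Numbers allow
  maxima over gaps to be taken and can later label the nodes of the tree.\<close>

definition weight :: "'a \<Rightarrow> 'a \<Rightarrow> nat" where
  "weight a b = (let I = if less a b then (a, b) else (b, a) in card {J \<in> intervals. outweighs I J})"

lemma weight_sym: "a \<in> A \<Longrightarrow> b \<in> A \<Longrightarrow> weight a b = weight b a"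
  using less_asym less_total by (cases "a = b") (auto simp: weight_def Let_def)

lemma outweighs_iff_weight:
  assumes "less a b" "less c d"
  shows "outweighs (a, b) (c, d) \<longleftrightarrow> weight c d \<le> weight a b"
proof -
  have w: "weight a b = card {J \<in> intervals. outweighs (a, b) J}"
    "weight c d = card {J \<in> intervals. outweighs (c, d) J}" using assms by (auto simp: weight_def)
  show ?thesis
  proof
    assume "outweighs (a, b) (c, d)"
    then have "{J \<in> intervals. outweighs (c, d) J} \<subseteq> {J \<in> intervals. outweighs (a, b) J}"
      using outweighs_trans[OF assms] by (auto simp: intervals_def)
    then show "weight c d \<le> weight a b" unfolding w by (intro card_mono) (auto simp: finite_intervals)
  next
    assume le: "weight c d \<le> weight a b"
    show "outweighs (a, b) (c, d)"
    proof (rule ccontr)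
      assume n: "\<not> outweighs (a, b) (c, d)"
      then have "outweighs (c, d) (a, b)" using outweighs_total assms by blast
      then have "{J \<in> intervals. outweighs (a, b) J} \<subseteq> {J \<in> intervals. outweighs (c, d) J}"
        using outweighs_trans[OF assms(2,1)] by (auto simp: intervals_def)
      moreover have "(c, d) \<in> {J \<in> intervals. outweighs (c, d) J}" "(c, d) \<notin> {J \<in> intervals. outweighs (a, b) J}"
        using n assms outweighs_total[of c d c d] by (auto simp: intervals_def)
      ultimately have "{J \<in> intervals. outweighs (a, b) J} \<subset> {J \<in> intervals. outweighs (c, d) J}"
        by blast
      then have "weight a b < weight c d" unfolding w by (intro psubset_card_mono) (auto simp: finite_intervals)
      with le show False by simp
    qed
  qed
qed

lemma weight_max:
  assumes "less a b" "less b c"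
  shows "weight a c = max (weight a b) (weight b c)"
proof -
  have ac: "less a c" using assms less_trans by blast
  show ?thesis
    using outweighs_subinterval[OF assms] subinterval_outweighs[OF assms] assms ac
    by (auto simp: outweighs_iff_weight max_def)
qed

section \<open>The column that decides a comparison\<close>

text \<open>Each step duplicates the column \<open>(a, b)\<close>: one copy is played off against
  the new column \<open>(e, f)\<close>, the other serves the induction hypothesis for the remaining
  columns. The spare copy is why the length bound exceeds the number of columns by one.\<close>

lemma dominating_column_aux:
  assumes ab: "less a b"
    and xs: "\<And>e f. (e, f) \<in> set xs \<Longrightarrow> e \<in> A \<and> f \<in> A \<and> P [e, a] [f, b]"
    and ys: "\<And>e f. (e, f) \<in> set ys \<Longrightarrow> e \<in> A \<and> f \<in> A \<and> P [a, e] [b, f]"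
    and "Suc (Suc (length xs + length ys)) \<le> M"
  shows "P (map fst xs @ a # map fst ys) (map snd xs @ b # map snd ys)"
  using xs ys assms(4)
proof (induction xs)
  case Nil
  then show ?case
  proof (induction ys)
    case Nil
    then show ?case using ab by (simp add: less_def)
  next
    case (Cons z ys)
    obtain e f where z: "z = (e, f)" by fastforce
    have IH: "P (a # map fst ys) (b # map snd ys)" using Cons by auto
    have ef: "e \<in> A" "f \<in> A" "P [a, e] [b, f]" using Cons.prems(2)[of e f] z by auto
    have A: "a \<in> A" "b \<in> A" "a \<noteq> b" using ab less_in less_neq by blast+
    have sub: "set (map fst ys) \<subseteq> A" "set (map snd ys) \<subseteq> A" using Cons.prems(2) by force+
    have len: "length ys + 3 \<le> M" using Cons.prems by simp
    have dg: "column_types X (zip (map fst ys) (map fst ys)) = []" for X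
      using column_types_zip_same[of X "map fst ys" "[]"] by simp
    have 1: "P (a # a # e # map fst ys) (a # b # f # map fst ys)"
      by (rule homog[OF ef(3)]) (use A ef sub len dg in auto)
    have 2: "P (a # b # f # map fst ys) (b # b # f # map snd ys)"
      by (rule homog[OF IH]) (use A ef sub len in auto)
    have 3: "P (a # a # e # map fst ys) (b # b # f # map snd ys)" using trans[OF 1 2] .
    show ?case
      by (rule homog[OF 3]) (use A ef sub len z in auto)
  qed
next
  case (Cons z xs)
  obtain e f where z: "z = (e, f)" by fastforce
  have IH: "P (map fst xs @ a # map fst ys) (map snd xs @ b # map snd ys)" using Cons by auto
  have ef: "e \<in> A" "f \<in> A" "P [e, a] [f, b]" using Cons.prems(1)[of e f] z by auto
  have A: "a \<in> A" "b \<in> A" "a \<noteq> b" using ab less_in less_neq by blast+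
  have sub: "set (map fst ys) \<subseteq> A" "set (map snd ys) \<subseteq> A" "set (map fst xs) \<subseteq> A" "set (map snd xs) \<subseteq> A"
    using Cons.prems(1,2) by force+
  have len: "length xs + length ys + 3 \<le> M" using Cons.prems by simp
  have dg: "column_types X (zip (map fst ys) (map fst ys)) = []" for X
    using column_types_zip_same[of X "map fst ys" "[]"] by simp
  have 1: "P (e # map fst xs @ a # a # map fst ys) (f # map fst xs @ b # a # map fst ys)"
    by (rule homog[OF ef(3)]) (use A ef sub len dg in \<open>auto simp: column_types_zip_same\<close>)
  have 2: "P (f # map fst xs @ b # a # map fst ys) (f # map snd xs @ b # b # map snd ys)"
    by (rule homog[OF IH]) (use A ef sub len in \<open>auto simp: column_types_append_diag\<close>)
  have 3: "P (e # map fst xs @ a # a # map fst ys) (f # map snd xs @ b # b # map snd ys)"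
    using trans[OF 1 2] .
  show ?case
    by (rule homog[OF 3]) (use A ef sub len z in \<open>auto simp: column_types_dup column_types_append_diag\<close>)
qed

text \<open>A column that goes up supports column \<open>i\<close>. One that goes down loses to it:
  in front of \<open>i\<close> because its weight is strictly smaller, behind \<open>i\<close>
  already at equal weight, since \<open>outweighs\<close> favours the earlier interval.\<close>

lemma dominating_column:
  assumes w: "length w = length w'" "set w \<subseteq> A" "set w' \<subseteq> A" "Suc (length w) \<le> M"
    and i: "i < length w" "less (w ! i) (w' ! i)"
    and before: "\<And>j. j < i \<Longrightarrow> w ! j \<noteq> w' ! j \<Longrightarrow> weight (w ! j) (w' ! j) < weight (w ! i) (w' ! i)"
    and after: "\<And>j. j < length w \<Longrightarrow> w ! j \<noteq> w' ! j \<Longrightarrow> weight (w ! j) (w' ! j) \<le> weight (w ! i) (w' ! i)"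
  shows "P w w'"
proof -
  let ?a = "w ! i" and ?b = "w' ! i"
  have A: "?a \<in> A" "?b \<in> A" "?a \<noteq> ?b" using i less_in less_neq by blast+
  have ab: "P [?a] [?b]" using i by (simp add: less_def)
  have inA: "w ! j \<in> A" "w' ! j \<in> A" if "j < length w" for j
    using that w by (auto simp: subset_iff)
  have up: "P [e, ?a] [f, ?b] \<and> P [?a, e] [?b, f]" if "e \<in> A" "f \<in> A" "e = f \<or> less e f" for e f
  proof (cases "e = f")
    case True
    have "P [f, ?a] [f, ?b]" "P [?a, f] [?b, f]"
      by (rule homog[OF ab]; use A that M3 in auto)+
    with True show ?thesis by simp
  next
    case False
    with that have ef: "P [e] [f]" by (auto simp: less_def)
    have "P [f, ?a] [f, ?b]" "P [?a, f] [?b, f]"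
      by (rule homog[OF ab]; use A that M3 in auto)+
    moreover have "P [e, ?a] [f, ?a]" "P [?a, e] [?a, f]"
      by (rule homog[OF ef]; use A that M3 in auto)+
    ultimately show ?thesis using trans by blast
  qed
  have 1: "P [w ! j, ?a] [w' ! j, ?b]" if "j < i" for j
  proof (cases "less (w' ! j) (w ! j)")
    case True
    have j: "w ! j \<in> A" "w' ! j \<in> A" using inA that i by auto
    have "w ! j \<noteq> w' ! j" using True less_neq by metis
    from before[OF that this] have "\<not> outweighs (w' ! j, w ! j) (?a, ?b)"
      using outweighs_iff_weight[OF True i(2)] weight_sym j by simp
    then have "\<not> P [w' ! j, ?b] [w ! j, ?a]" by (simp add: outweighs_def)
    then show ?thesis using total[of "[w' ! j, ?b]" "[w ! j, ?a]"] j A M3 by auto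
  next
    case False
    with less_total inA that i have "w ! j = w' ! j \<or> less (w ! j) (w' ! j)" by (metis order.strict_trans)
    with up inA that i show ?thesis by (meson order.strict_trans)
  qed
  have 2: "P [?a, w ! j] [?b, w' ! j]" if "j < length w" for j
  proof (cases "less (w' ! j) (w ! j)")
    case True
    have j: "w ! j \<in> A" "w' ! j \<in> A" using inA that by auto
    have "w ! j \<noteq> w' ! j" using True less_neq by metis
    from after[OF that this] have "outweighs (?a, ?b) (w' ! j, w ! j)"
      using outweighs_iff_weight[OF i(2) True] weight_sym j by simp
    then show ?thesis by (simp add: outweighs_def)
  next
    case False
    with less_total inA that have "w ! j = w' ! j \<or> less (w ! j) (w' ! j)" by metis
    with up inA that show ?thesis by blast
  qed
  let ?xs = "zip (take i w) (take i w')" and ?ys = "zip (drop (Suc i) w) (drop (Suc i) w')"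
  have "P (map fst ?xs @ ?a # map fst ?ys) (map snd ?xs @ ?b # map snd ?ys)"
  proof (rule dominating_column_aux[OF i(2)])
    fix e f assume "(e, f) \<in> set ?xs"
    then obtain j where "j < i" "e = w ! j" "f = w' ! j" using i w by (auto simp: set_zip)
    then show "e \<in> A \<and> f \<in> A \<and> P [e, ?a] [f, ?b]" using 1 inA i by auto
  next
    fix e f assume "(e, f) \<in> set ?ys"
    then obtain n where n: "e = w ! (Suc i + n)" "f = w' ! (Suc i + n)" "Suc i + n < length w"
      using i w by (auto simp: set_zip)
    then show "e \<in> A \<and> f \<in> A \<and> P [?a, e] [?b, f]" using 2[OF n(3)] inA[OF n(3)] by simp
  next
    show "Suc (Suc (length ?xs + length ?ys)) \<le> M" using w i by simp
  qed
  moreover have "map fst ?xs @ ?a # map fst ?ys = w" "map snd ?xs @ ?b # map snd ?ys = w'"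
    using w i by (simp_all add: id_take_nth_drop[symmetric])
  ultimately show ?thesis by simp
qed

section \<open>Reduction to the gaps between consecutive letters\<close>

definition position :: "'a \<Rightarrow> nat" where
  "position a = card {b \<in> A. less b a}"

lemma position_less: "a \<in> A \<Longrightarrow> position a < card A"
  unfolding position_def using less_irrefl by (intro psubset_card_mono fin) blast

lemma position_mono:
  assumes "less a b"
  shows "position a < position b"
proof -
  have "{c \<in> A. less c a} \<subset> {c \<in> A. less c b}"
    using assms less_trans less_irrefl less_in by blast
  then show ?thesis unfolding position_def using fin by (intro psubset_card_mono) auto
qed

lemma position_less_iff: "a \<in> A \<Longrightarrow> b \<in> A \<Longrightarrow> position a < position b \<longleftrightarrow> less a b"
  using position_mono less_total by (metis less_irrefl order_less_asym order_less_irrefl)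

lemma bij_position: "bij_betw position A {..<card A}"
proof (rule bij_betw_imageI)
  show inj: "inj_on position A"
    using position_mono less_total by (metis inj_onI order_less_irrefl)
  have "position ` A \<subseteq> {..<card A}" using position_less by auto
  then show "position ` A = {..<card A}"
    by (intro card_subset_eq) (simp_all add: card_image inj)
qed

definition letter_at :: "nat \<Rightarrow> 'a" where
  "letter_at = inv_into A position"

lemma letter_at:
  "i < card A \<Longrightarrow> letter_at i \<in> A" "i < card A \<Longrightarrow> position (letter_at i) = i"
  "a \<in> A \<Longrightarrow> letter_at (position a) = a"
proof -
  assume "i < card A"
  then have "i \<in> position ` A" using bij_position by (simp add: bij_betw_def)
  then show "letter_at i \<in> A" "position (letter_at i) = i"
    unfolding letter_at_def by (rule inv_into_into, rule f_inv_into_f)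
next
  assume "a \<in> A"
  then show "letter_at (position a) = a"
    unfolding letter_at_def using bij_position by (simp add: bij_betw_def)
qed

text \<open>Iterating \<open>weight_max\<close> reduces all weights to those of the
  \<open>card A - 1\<close> gaps, the only data from which the tree is built.\<close>

lemma weight_letter_at:
  assumes "i < j" "j < card A"
  shows "weight (letter_at i) (letter_at j) =
    Max ((\<lambda>i. weight (letter_at i) (letter_at (Suc i))) ` {i..<j})"
  using assms
proof (induction j)
  case (Suc j)
  show ?case
  proof (cases "i = j")
    case False
    with Suc.prems have ij: "i < j" "j < card A" by auto
    have "less (letter_at i) (letter_at j)" "less (letter_at j) (letter_at (Suc j))"
      using ij Suc.prems by (simp_all add: position_less_iff[symmetric] letter_at)
    from weight_max[OF this] Suc.IH[OF ij] ij show ?thesis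
      by (simp add: atLeastLessThanSuc max.commute)
  qed simp
qed simp

end

section \<open>Trees from gap weights\<close>

text \<open>Putting \<open>n\<close> subtrees in front of the children of the root changes only the
  first index of a path, and the root \<open>[]\<close> stays fixed.\<close>

definition shift_path :: "nat \<Rightarrow> nat list \<Rightarrow> nat list" where
  "shift_path n p = (case p of [] \<Rightarrow> [] | i # q \<Rightarrow> (n + i) # q)"

lemma shift_path_simps [simp]: "shift_path n [] = []" "shift_path n (i # q) = (n + i) # q"
  by (simp_all add: shift_path_def)

lemma shift_path_eq_Nil [simp]: "shift_path n p = [] \<longleftrightarrow> p = []"
  by (cases p) auto

lemma shift_path_eq [simp]: "shift_path n p = shift_path n q \<longleftrightarrow> p = q"
  by (cases p; cases q) auto

lemma length_shift_path [simp]: "length (shift_path n p) = length p"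
  by (cases p) auto

lemma prefix_shift_path [simp]: "prefix (shift_path n p) (shift_path n q) \<longleftrightarrow> prefix p q"
  by (cases p; cases q) auto

lemma strict_prefix_shift_path [simp]:
  "strict_prefix (shift_path n p) (shift_path n q) \<longleftrightarrow> strict_prefix p q"
  by (simp only: strict_prefix_def prefix_shift_path shift_path_eq)

lemma map2_upt_append:
  "map2 f [0..<length (xs @ ys)] (xs @ ys) =
     map2 f [0..<length xs] xs @ map2 (\<lambda>i. f (length xs + i)) [0..<length ys] ys"
proof (rule nth_equalityI)
  fix i assume "i < length (map2 f [0..<length (xs @ ys)] (xs @ ys))"
  then show "map2 f [0..<length (xs @ ys)] (xs @ ys) ! i =
    (map2 f [0..<length xs] xs @ map2 (\<lambda>i. f (length xs + i)) [0..<length ys] ys) ! i"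
    by (simp add: nth_append)
qed simp

lemma leaves_append:
  "leaves (Node (ts @ us)) = leaves (Node ts) @ map (shift_path (length ts)) (leaves (Node us))"
  using map2_upt_append[of "\<lambda>i ls. map ((#) i) ls" "map leaves ts" "map leaves us"]
  by (simp add: map_concat comp_def case_prod_beta')

lemma internal_nodes_append:
  "internal_nodes (Node (ts @ us)) =
     internal_nodes (Node ts) \<union> shift_path (length ts) ` internal_nodes (Node us)"
proof -
  have "set (map2 (\<lambda>i N. (#) i ` N) [0..<length (ts @ us)] (map internal_nodes (ts @ us))) =
    set (map2 (\<lambda>i N. (#) i ` N) [0..<length ts] (map internal_nodes ts)) \<union>
    (`) (shift_path (length ts)) ` set (map2 (\<lambda>i N. (#) i ` N) [0..<length us] (map internal_nodes us))"
    using map2_upt_append[of "\<lambda>i N. (#) i ` N" "map internal_nodes ts" "map internal_nodes us"]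
    by (simp add: image_image case_prod_beta' del: upt_Suc)
  then show ?thesis
    by (simp only: internal_nodes.simps) (simp add: image_UN image_Union image_image Un_assoc)
qed

lemma Nil_in_internal_nodes [simp]: "[] \<in> internal_nodes (Node ts)"
  by simp

lemma hd_internal_nodes: "p \<in> internal_nodes (Node ts) \<Longrightarrow> p \<noteq> [] \<Longrightarrow> hd p < length ts"
  by (auto simp: in_set_zip dest!: set_zip_leftD)

lemma hd_leaves: "p \<in> set (leaves (Node ts)) \<Longrightarrow> p \<noteq> [] \<and> hd p < length ts"
  by (auto dest!: set_zip_leftD)

declare internal_nodes.simps(2) [simp del] leaves.simps(2) [simp del]

section \<open>Labelled trees with prescribed gap weights\<close>

definition decreasing_label :: "plane_tree \<Rightarrow> (nat list \<Rightarrow> nat) \<Rightarrow> bool" where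
  "decreasing_label T \<rho> \<longleftrightarrow>
     (\<forall>p \<in> internal_nodes T. \<forall>q \<in> internal_nodes T. strict_prefix p q \<longrightarrow> \<rho> q < \<rho> p)"

definition lca_label :: "plane_tree \<Rightarrow> (nat list \<Rightarrow> nat) \<Rightarrow> nat list \<Rightarrow> nat list \<Rightarrow> nat \<Rightarrow> bool" where
  "lca_label T \<rho> a b m \<longleftrightarrow> (\<exists>p \<in> internal_nodes T. prefix p a \<and> prefix p b \<and> \<rho> p = m \<and>
     (\<forall>q \<in> internal_nodes T. prefix q a \<longrightarrow> prefix q b \<longrightarrow> length q \<le> length p))"

text \<open>Here \<open>gs ! i\<close> belongs to the gap between the leaves \<open>i\<close> and
  \<open>i + 1\<close>. A Schroeder tree with this property is a Cartesian tree of
  \<open>gs\<close>, largest entry on top, with equal maxima merged into one node.\<close>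

definition realizes_gaps :: "nat list \<Rightarrow> plane_tree \<Rightarrow> (nat list \<Rightarrow> nat) \<Rightarrow> bool" where
  "realizes_gaps gs T \<rho> \<longleftrightarrow> length (leaves T) = Suc (length gs) \<and> decreasing_label T \<rho> \<and>
     (\<forall>i j. i < j \<longrightarrow> j \<le> length gs \<longrightarrow>
        lca_label T \<rho> (leaves T ! i) (leaves T ! j) (Max ((!) gs ` {i..<j})))"

text \<open>The two roots, both labelled \<open>m\<close>, are fused. Common ancestors within one
  part keep their labels; leaves of different parts meet only at the root, and the gap
  \<open>m\<close> between the parts is a maximum because \<open>m\<close> bounds all
  weights.\<close>

lemma realizes_gaps_append:
  assumes 1: "realizes_gaps gs (Node ts) \<rho>" "\<rho> [] = m" "\<forall>g\<in>set gs. g \<le> m"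
    and 2: "realizes_gaps gs' (Node ts') \<rho>'" "\<rho>' [] = m" "\<forall>g\<in>set gs'. g \<le> m"
  shows "\<exists>\<sigma>. realizes_gaps (gs @ m # gs') (Node (ts @ ts')) \<sigma> \<and> \<sigma> [] = m"
proof -
  let ?n = "length ts" and ?T = "Node (ts @ ts')"
  let ?I = "internal_nodes (Node ts)" and ?I' = "internal_nodes (Node ts')"
  define \<sigma> where "\<sigma> p = (if p = [] then m else if hd p < ?n then \<rho> p else \<rho>' ((hd p - ?n) # tl p))" for p
  have I: "internal_nodes ?T = ?I \<union> shift_path ?n ` ?I'" by (rule internal_nodes_append)
  have \<sigma>1: "\<sigma> p = \<rho> p" if "p \<in> ?I" for p
    using that 1(2) hd_internal_nodes[OF that] by (auto simp: \<sigma>_def)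
  have \<sigma>2: "\<sigma> (shift_path ?n p) = \<rho>' p" for p
    using 2(2) by (cases p) (auto simp: \<sigma>_def)
  have hd2: "?n \<le> hd (shift_path ?n p)" if "p \<noteq> []" for p
    using that by (cases p) auto
  have hd_prefix: "hd p = hd q" if "prefix p q" "p \<noteq> []" for p q :: "nat list"
    using that by (cases p; cases q) auto
  \<comment> \<open>Below the fused root the first index of a path tells the two parts
    apart.\<close>
  have clash: "p = []" if "p \<in> ?I" "prefix p (shift_path ?n q)" for p q
  proof (rule ccontr)
    assume "p \<noteq> []"
    with that(2) have "q \<noteq> []" by auto
    with hd2[of q] hd_prefix[OF that(2) \<open>p \<noteq> []\<close>] hd_internal_nodes[OF that(1) \<open>p \<noteq> []\<close>]
    show False by simp
  qed
  have clash': "p = []" if "prefix (shift_path ?n p) q" "q = [] \<or> hd q < ?n" for p q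
  proof (rule ccontr)
    assume "p \<noteq> []"
    with that have "q \<noteq> []" "hd (shift_path ?n p) = hd q" using hd_prefix[of "shift_path ?n p" q] by auto
    with that hd2[OF \<open>p \<noteq> []\<close>] show False by simp
  qed
  have dec: "decreasing_label ?T \<sigma>"
    unfolding decreasing_label_def
  proof (intro ballI impI)
    fix p q assume p: "p \<in> internal_nodes ?T" and q: "q \<in> internal_nodes ?T" and pq: "strict_prefix p q"
    have d1: "\<rho> q < \<rho> p" if "p \<in> ?I" "q \<in> ?I" "strict_prefix p q" for p q
      using 1(1) that by (auto simp: realizes_gaps_def decreasing_label_def)
    have d2: "\<rho>' q < \<rho>' p" if "p \<in> ?I'" "q \<in> ?I'" "strict_prefix p q" for p q
      using 2(1) that by (auto simp: realizes_gaps_def decreasing_label_def)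
    from q consider "q \<in> ?I" | q' where "q = shift_path ?n q'" "q' \<in> ?I'" unfolding I by blast
    then show "\<sigma> q < \<sigma> p"
    proof cases
      case 1
      have "p \<in> ?I"
      proof (cases "p \<in> ?I")
        case False
        with p obtain p' where "p = shift_path ?n p'" unfolding I by blast
        with clash'[of p' q] pq hd_internal_nodes[OF 1] have "p = []" by (auto simp: strict_prefix_def)
        then show ?thesis by simp
      qed
      with 1 pq d1 \<sigma>1 show ?thesis by simp
    next
      case 2
      have "\<exists>p'. p = shift_path ?n p' \<and> p' \<in> ?I'"
      proof (cases "p \<in> ?I")
        case True
        with clash[of p q'] pq 2 have "p = []" by (auto simp: strict_prefix_def)
        then show ?thesis by (intro exI[of _ "[]"]) simp
      next
        case False
        with p show ?thesis unfolding I by blast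
      qed
      then obtain p' where "p = shift_path ?n p'" "p' \<in> ?I'" by blast
      with 2 pq d2 \<sigma>2 show ?thesis by simp
    qed
  qed
  have len: "length (leaves (Node ts)) = Suc (length gs)" "length (leaves (Node ts')) = Suc (length gs')"
    using 1(1) 2(1) by (auto simp: realizes_gaps_def)
  have l1: "leaves ?T ! i = leaves (Node ts) ! i" if "i \<le> length gs" for i
    using that len unfolding leaves_append by (simp only: nth_append) simp
  have l2: "leaves ?T ! (Suc (length gs) + i) = shift_path ?n (leaves (Node ts') ! i)"
    if "i \<le> length gs'" for i
    using that len unfolding leaves_append by (simp only: nth_append) simp
  have hd1: "leaves (Node ts) ! i \<noteq> [] \<and> hd (leaves (Node ts) ! i) < ?n" if "i \<le> length gs" for i
    using hd_leaves[OF nth_mem, of i ts] that len by simp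
  have lca1: "lca_label ?T \<sigma> (leaves ?T ! i) (leaves ?T ! j) (Max ((!) (gs @ m # gs') ` {i..<j}))"
    if "i < j" "j \<le> length gs" for i j
  proof -
    let ?a = "leaves (Node ts) ! i" and ?b = "leaves (Node ts) ! j"
    have "lca_label (Node ts) \<rho> ?a ?b (Max ((!) gs ` {i..<j}))"
      using 1(1) that by (auto simp: realizes_gaps_def)
    then obtain p where p: "p \<in> ?I" "prefix p ?a" "prefix p ?b" "\<rho> p = Max ((!) gs ` {i..<j})"
      "\<And>q. q \<in> ?I \<Longrightarrow> prefix q ?a \<Longrightarrow> prefix q ?b \<Longrightarrow> length q \<le> length p"
      unfolding lca_label_def by blast
    have eq: "(!) (gs @ m # gs') ` {i..<j} = (!) gs ` {i..<j}"
      using that by (intro image_cong) (auto simp: nth_append)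
    have mx: "length q \<le> length p" if q: "q \<in> ?I \<union> shift_path ?n ` ?I'" "prefix q ?a" "prefix q ?b" for q
    proof (cases "q \<in> ?I")
      case False
      with q obtain q' where "q = shift_path ?n q'" by blast
      with clash'[of q' ?a] q hd1[of i] \<open>i < j\<close> \<open>j \<le> length gs\<close> show ?thesis by simp
    qed (use p q in blast)
    have "lca_label ?T \<sigma> ?a ?b (Max ((!) gs ` {i..<j}))"
      unfolding lca_label_def I
      by (intro bexI[of _ p] conjI ballI impI; (rule mx, assumption+)?) (simp_all add: p \<sigma>1)
    then show ?thesis using that l1 eq by simp
  qed
  have lca2: "lca_label ?T \<sigma> (leaves ?T ! (Suc (length gs) + i)) (leaves ?T ! (Suc (length gs) + j))
      (Max ((!) (gs @ m # gs') ` {Suc (length gs) + i..<Suc (length gs) + j}))"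
    if "i < j" "j \<le> length gs'" for i j
  proof -
    let ?a = "leaves (Node ts') ! i" and ?b = "leaves (Node ts') ! j"
    have "lca_label (Node ts') \<rho>' ?a ?b (Max ((!) gs' ` {i..<j}))"
      using 2(1) that by (auto simp: realizes_gaps_def)
    then obtain p where p: "p \<in> ?I'" "prefix p ?a" "prefix p ?b" "\<rho>' p = Max ((!) gs' ` {i..<j})"
      "\<And>q. q \<in> ?I' \<Longrightarrow> prefix q ?a \<Longrightarrow> prefix q ?b \<Longrightarrow> length q \<le> length p"
      unfolding lca_label_def by blast
    have "{Suc (length gs) + i..<Suc (length gs) + j} = (+) (Suc (length gs)) ` {i..<j}"
      by (simp only: image_add_atLeastLessThan add.commute)
    then have eq: "(!) (gs @ m # gs') ` {Suc (length gs) + i..<Suc (length gs) + j} = (!) gs' ` {i..<j}"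
      by (simp only: image_image) (simp add: nth_append)
    have mx: "length q \<le> length (shift_path ?n p)" if q: "q \<in> ?I \<union> shift_path ?n ` ?I'"
      "prefix q (shift_path ?n ?a)" "prefix q (shift_path ?n ?b)" for q
    proof (cases "q \<in> ?I")
      case True
      from clash[OF True q(2)] show ?thesis by simp
    qed (use p q in auto)
    have "lca_label ?T \<sigma> (shift_path ?n ?a) (shift_path ?n ?b) (Max ((!) gs' ` {i..<j}))"
      unfolding lca_label_def I
      by (intro bexI[of _ "shift_path ?n p"] conjI ballI impI; (rule mx, assumption+)?)
         (simp_all add: p \<sigma>2)
    then show ?thesis using that l2 eq by simp
  qed
  have lca3: "lca_label ?T \<sigma> (leaves ?T ! i) (leaves ?T ! (Suc (length gs) + j))
      (Max ((!) (gs @ m # gs') ` {i..<Suc (length gs) + j}))"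
    if "i \<le> length gs" "j \<le> length gs'" for i j
  proof -
    let ?a = "leaves (Node ts) ! i" and ?b = "leaves (Node ts') ! j"
    have "Max ((!) (gs @ m # gs') ` {i..<Suc (length gs) + j}) = m"
    proof (rule Max_eqI)
      fix y assume "y \<in> (!) (gs @ m # gs') ` {i..<Suc (length gs) + j}"
      then have "y \<in> set (gs @ m # gs')" using that by (force simp del: set_append)
      then show "y \<le> m" using 1(3) 2(3) by auto
    next
      show "m \<in> (!) (gs @ m # gs') ` {i..<Suc (length gs) + j}"
        using that by (intro image_eqI[of _ _ "length gs"]) auto
    qed simp
    moreover have mx: "length q \<le> length ([] :: nat list)" if q: "q \<in> ?I \<union> shift_path ?n ` ?I'"
      "prefix q ?a" "prefix q (shift_path ?n ?b)" for q
    proof (cases "q \<in> ?I")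
      case True
      from clash[OF True q(3)] show ?thesis by simp
    next
      case False
      with q obtain q' where "q = shift_path ?n q'" by blast
      with clash'[of q' ?a] q hd1[of i] \<open>i \<le> length gs\<close> show ?thesis by simp
    qed
    moreover have "\<sigma> [] = m" by (simp add: \<sigma>_def)
    ultimately have "lca_label ?T \<sigma> ?a (shift_path ?n ?b) (Max ((!) (gs @ m # gs') ` {i..<Suc (length gs) + j}))"
      unfolding lca_label_def I
      by (intro bexI[of _ "[]"] conjI ballI impI; (rule mx, assumption+)?) simp_all
    then show ?thesis using that l1 l2 by simp
  qed
  have "realizes_gaps (gs @ m # gs') ?T \<sigma>"
    unfolding realizes_gaps_def
  proof (intro conjI allI impI dec)
    show "length (leaves ?T) = Suc (length (gs @ m # gs'))" using len unfolding leaves_append by simp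
    fix i j assume ij: "i < j" "j \<le> length (gs @ m # gs')"
    show "lca_label ?T \<sigma> (leaves ?T ! i) (leaves ?T ! j) (Max ((!) (gs @ m # gs') ` {i..<j}))"
    proof (cases "j \<le> length gs")
      case True
      with ij lca1 show ?thesis by blast
    next
      case False
      then have j: "j = Suc (length gs) + (j - Suc (length gs))" by simp
      show ?thesis
      proof (cases "i \<le> length gs")
        case True
        with lca3[of i "j - Suc (length gs)"] ij j show ?thesis by simp
      next
        case False
        then have i: "i = Suc (length gs) + (i - Suc (length gs))" by simp
        with lca2[of "i - Suc (length gs)" "j - Suc (length gs)"] ij j show ?thesis by simp
      qed
    qed
  qed
  moreover have "\<sigma> [] = m" by (simp add: \<sigma>_def)
  ultimately show ?thesis by blast
qed

text \<open>The new root has a single child and is not a Schroeder node itself. It turns a finished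
  tree into a one-element child list under the label \<open>m\<close>, ready to be joined by
  \<open>realizes_gaps_append\<close>.\<close>

lemma realizes_gaps_lift:
  assumes "realizes_gaps gs (Node ts) \<rho>" "\<rho> [] < m"
  shows "\<exists>\<sigma>. realizes_gaps gs (Node [Node ts]) \<sigma> \<and> \<sigma> [] = m"
proof -
  let ?T = "Node [Node ts]" and ?I = "internal_nodes (Node ts)"
  define \<sigma> where "\<sigma> p = (case p of [] \<Rightarrow> m | i # q \<Rightarrow> \<rho> q)" for p
  have [simp]: "\<sigma> [] = m" "\<sigma> (i # q) = \<rho> q" for i q by (simp_all add: \<sigma>_def)
  have I: "internal_nodes ?T = insert [] ((#) 0 ` ?I)"
    by (simp add: internal_nodes.simps(2)[of "[Node ts]"])
  have L: "leaves ?T = map ((#) 0) (leaves (Node ts))"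
    by (simp add: leaves.simps(2)[of "[Node ts]"])
  have d: "\<rho> q < \<rho> p" if "p \<in> ?I" "q \<in> ?I" "strict_prefix p q" for p q
    using assms(1) that by (auto simp: realizes_gaps_def decreasing_label_def)
  have m: "\<rho> p < m" if "p \<in> ?I" for p
    using d[OF Nil_in_internal_nodes that] assms(2) by (cases "p = []") (auto simp: strict_prefix_def)
  then have "decreasing_label ?T \<sigma>"
    unfolding decreasing_label_def I using d m by (auto simp: strict_prefix_def)
  moreover have "lca_label ?T \<sigma> (0 # a) (0 # b) v" if "lca_label (Node ts) \<rho> a b v" for a b v
  proof -
    from that obtain p where p: "p \<in> ?I" "prefix p a" "prefix p b" "\<rho> p = v"
      "\<And>q. q \<in> ?I \<Longrightarrow> prefix q a \<Longrightarrow> prefix q b \<Longrightarrow> length q \<le> length p"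
      unfolding lca_label_def by blast
    show ?thesis unfolding lca_label_def I
      by (rule bexI[of _ "0 # p"]) (use p in auto)
  qed
  ultimately have "realizes_gaps gs ?T \<sigma>"
    using assms(1) unfolding realizes_gaps_def L by simp
  then show ?thesis using \<open>\<sigma> [] = m\<close> by blast
qed

text \<open>The root is cut at every occurrence of the maximal gap weight. The induction produces the
  list of subtrees below a root of any label \<open>m\<close> that bounds the weights, so this list can
  have a single element.\<close>
lemma realizing_forest:
  "\<forall>g\<in>set gs. g \<le> m \<Longrightarrow> \<exists>ts \<rho>. ts \<noteq> [] \<and> (m \<in> set gs \<longrightarrow> 2 \<le> length ts) \<and>
     (\<forall>t\<in>set ts. schroeder_tree t) \<and> realizes_gaps gs (Node ts) \<rho> \<and> \<rho> [] = m"
proof (induction "length gs" arbitrary: gs m rule: less_induct)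
  case less
  have max_in: "\<exists>ts \<rho>. 2 \<le> length ts \<and>
     (\<forall>t\<in>set ts. schroeder_tree t) \<and> realizes_gaps gs (Node ts) \<rho> \<and> \<rho> [] = m"
    if m: "m \<in> set gs" "\<forall>g\<in>set gs. g \<le> m" for m
  proof -
    from m(1) obtain gs1 gs2 where gs: "gs = gs1 @ m # gs2" by (meson split_list)
    obtain ts1 \<rho>1 where 1: "ts1 \<noteq> []" "\<forall>t\<in>set ts1. schroeder_tree t"
      "realizes_gaps gs1 (Node ts1) \<rho>1" "\<rho>1 [] = m"
      using less.hyps[of gs1 m] m gs by auto
    obtain ts2 \<rho>2 where 2: "ts2 \<noteq> []" "\<forall>t\<in>set ts2. schroeder_tree t"
      "realizes_gaps gs2 (Node ts2) \<rho>2" "\<rho>2 [] = m"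
      using less.hyps[of gs2 m] m gs by auto
    obtain \<sigma> where \<sigma>: "realizes_gaps gs (Node (ts1 @ ts2)) \<sigma>" "\<sigma> [] = m"
      using realizes_gaps_append[OF 1(3,4) _ 2(3,4)] m(2) gs by auto
    have "2 \<le> length (ts1 @ ts2)" using 1(1) 2(1) by (cases ts1; cases ts2) simp_all
    moreover have "\<forall>t\<in>set (ts1 @ ts2). schroeder_tree t" using 1(2) 2(2) by auto
    ultimately show ?thesis using \<sigma> by blast
  qed
  show ?case
  proof (cases "m \<in> set gs")
    case True
    from max_in[OF this less.prems] obtain ts \<rho> where ts: "2 \<le> length ts"
      "(\<forall>t\<in>set ts. schroeder_tree t) \<and> realizes_gaps gs (Node ts) \<rho> \<and> \<rho> [] = m" by blast
    then have "ts \<noteq> []" by auto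
    with ts show ?thesis by (intro exI[of _ ts] exI[of _ \<rho>]) simp
  next
    case False
    show ?thesis
    proof (cases "gs = []")
      case True
      have "realizes_gaps [] (Node [Leaf]) (\<lambda>_. m)"
        by (auto simp: realizes_gaps_def decreasing_label_def internal_nodes.simps leaves.simps)
      with True show ?thesis by (intro exI[of _ "[Leaf]"] exI[of _ "\<lambda>_. m"]) simp
    next
      case gs: False
      \<comment> \<open>When \<open>m\<close> exceeds every gap weight, the whole list becomes one
        subtree, cut at its own maximum.\<close>
      let ?m = "Max (set gs)"
      have "?m \<in> set gs" using gs by simp
      then have "?m < m" using less.prems False by (metis le_neq_implies_less)
      obtain ts \<rho> where ts: "2 \<le> length ts" "\<forall>t\<in>set ts. schroeder_tree t"
        "realizes_gaps gs (Node ts) \<rho>" "\<rho> [] = ?m"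
        using max_in[OF \<open>?m \<in> set gs\<close>] by (metis List.finite_set Max_ge)
      obtain \<sigma> where "realizes_gaps gs (Node [Node ts]) \<sigma>" "\<sigma> [] = m"
        using realizes_gaps_lift[OF ts(3)] ts(4) \<open>?m < m\<close> by auto
      moreover have "schroeder_tree (Node ts)" using ts by (simp add: list_all_iff)
      ultimately show ?thesis using False
        by (intro exI[of _ "[Node ts]"] exI[of _ \<sigma>]) (simp del: schroeder_tree.simps)
    qed
  qed
qed

text \<open>Taking the maximal gap weight as root label forces at least two children; without gaps
  the tree is a leaf.\<close>

lemma realizing_tree: "\<exists>T \<rho>. schroeder_tree T \<and> realizes_gaps gs T \<rho>"
proof (cases "gs = []")
  case True
  have "realizes_gaps [] Leaf (\<lambda>_. 0)" by (simp add: realizes_gaps_def decreasing_label_def)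
  with True show ?thesis by (intro exI[of _ Leaf]) auto
next
  case False
  then have "Max (set gs) \<in> set gs" "\<forall>g\<in>set gs. g \<le> Max (set gs)" by simp_all
  from realizing_forest[OF this(2)] this(1) obtain ts \<rho> where "2 \<le> length ts"
    "\<forall>t\<in>set ts. schroeder_tree t" "realizes_gaps gs (Node ts) \<rho>" by blast
  then show ?thesis by (intro exI[of _ "Node ts"] exI[of _ \<rho>]) (simp add: list_all_iff)
qed

text \<open>\<open>ARG_MAX\<close> chooses among maximizers; here it is determined, since two
  prefixes of one path with equal length coincide.\<close>

lemma lowest_common_label:
  assumes "lca_label T \<rho> (leaf_of k lt T a) (leaf_of k lt T b) m"
  shows "lowest_common k lt T a b \<in> internal_nodes T" "\<rho> (lowest_common k lt T a b) = m"
proof -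
  let ?a = "leaf_of k lt T a" and ?b = "leaf_of k lt T b"
  let ?P = "\<lambda>p. p \<in> internal_nodes T \<and> prefix p ?a \<and> prefix p ?b"
  from assms obtain p where p: "?P p" "\<rho> p = m" "\<And>q. ?P q \<Longrightarrow> length q \<le> length p"
    unfolding lca_label_def by blast
  have "arg_max length ?P = p"
  proof (rule arg_maxI[of ?P p length])
    show "?P p" by (rule p(1))
    show "\<not> length p < length q" if "?P q" for q using p(3)[OF that] by simp
    fix q assume q: "?P q" "\<forall>r. ?P r \<longrightarrow> \<not> length q < length r"
    with p have "length q = length p" by (metis le_antisym not_less)
    moreover have "prefix q p \<or> prefix p q" using p(1) q(1) prefix_same_cases by blast
    ultimately show "q = p" by (auto simp: prefix_def)
  qed
  then have "lowest_common k lt T a b = p" by (simp add: lowest_common_def)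
  with p show "lowest_common k lt T a b \<in> internal_nodes T" "\<rho> (lowest_common k lt T a b) = m"
    by simp_all
qed

definition label_order :: "plane_tree \<Rightarrow> (nat list \<Rightarrow> nat) \<Rightarrow> nat list rel" where
  "label_order T \<rho> = {(q, p). q \<in> internal_nodes T \<and> p \<in> internal_nodes T \<and> \<rho> q \<le> \<rho> p}"

lemma weakly_decreasing_label_order:
  assumes "schroeder_tree T" "decreasing_label T \<rho>"
  shows "weakly_decreasing_schroeder_tree T (label_order T \<rho>)"
  using assms unfolding weakly_decreasing_schroeder_tree_def decreasing_label_def label_order_def
  by (fastforce simp: preorder_on_def refl_on_def trans_def total_on_def)

section \<open>The canonical ordering theorem\<close>

text \<open>The label of the lowest common node of two distinct letters is their weight. So the
  decisive index is the first column of maximal weight, and \<open>dominating_column\<close> applies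
  to \<open>w\<close>, \<open>w'\<close> or to the swapped pair.\<close>

lemma tree_representation:
  assumes "homogeneous_order A M P" "1 \<le> k" "Suc d \<le> M" and A: "A = {1..k}"
  shows "\<exists>T le lt. weakly_decreasing_schroeder_tree T le \<and> length (leaves T) = k
    \<and> strict_linear_ordering {1..k} lt
    \<and> tree_ordering k d lt T le = {(w, w'). w \<in> words k d \<and> w' \<in> words k d \<and> P w w'}"
proof -
  have card_A: "card A = k" by (simp add: A)
  interpret H: homogeneous_order A M P by (rule assms(1))
  define gap where "gap i = H.weight (H.letter_at i) (H.letter_at (Suc i))" for i
  define gs where "gs = map gap [0..<k - 1]"
  have len_gs: "length gs = k - 1" by (simp add: gs_def)
  obtain T \<rho> where T: "schroeder_tree T" "realizes_gaps gs T \<rho>" using realizing_tree by blast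
  define lt where "lt = {(a, b). H.less a b}"
  define le where "le = label_order T \<rho>"
  have len: "length (leaves T) = k" using T(2) assms(2) by (simp add: realizes_gaps_def gs_def)
  have tree: "weakly_decreasing_schroeder_tree T le"
    unfolding le_def using T by (intro weakly_decreasing_label_order) (auto simp: realizes_gaps_def)
  have lin: "strict_linear_ordering {1..k} lt"
    unfolding strict_linear_ordering_def strict_linear_order_on_def
  proof (intro conjI)
    show "lt \<subseteq> {1..k} \<times> {1..k}" unfolding lt_def using H.less_in A by blast
    show "trans lt" unfolding lt_def trans_def using H.less_trans by blast
    show "irrefl lt" unfolding lt_def irrefl_def using H.less_irrefl by blast
    show "total_on {1..k} lt" unfolding lt_def total_on_def using H.less_total A by blast
  qed
  have leaf: "leaf_of k lt T a = leaves T ! H.position a" for a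
    unfolding leaf_of_def H.position_def lt_def A[symmetric] by simp
  have lca_less: "lowest_common k lt T a b \<in> internal_nodes T \<and> \<rho> (lowest_common k lt T a b) = H.weight a b"
    if "H.less a b" for a b
  proof -
    let ?i = "H.position a" and ?j = "H.position b"
    have ij: "?i < ?j" "?j < k"
      using H.position_mono[OF that] H.position_less[OF H.less_in(2)[OF that]] card_A by simp_all
    have "H.weight a b = Max (gap ` {?i..<?j})"
      using H.weight_letter_at[of ?i ?j] ij H.letter_at(3) H.less_in[OF that] card_A by (simp add: gap_def)
    also have "gap ` {?i..<?j} = (!) gs ` {?i..<?j}"
      using ij by (intro image_cong) (auto simp: gs_def)
    finally have "lca_label T \<rho> (leaf_of k lt T a) (leaf_of k lt T b) (H.weight a b)"
      using T(2) ij len_gs by (simp add: realizes_gaps_def leaf)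
    from lowest_common_label[OF this] show ?thesis by simp
  qed
  have lca: "lowest_common k lt T a b \<in> internal_nodes T \<and> \<rho> (lowest_common k lt T a b) = H.weight a b"
    if "a \<in> A" "b \<in> A" "a \<noteq> b" for a b
  proof (cases "H.less a b")
    case False
    with that H.less_total have "H.less b a" by blast
    from lca_less[OF this] H.weight_sym[OF that(1,2)] show ?thesis
      by (simp add: lowest_common_def conj_commute)
  qed (rule lca_less)
  have decide: "(w ! i, w' ! i) \<in> lt \<longleftrightarrow> P w w'"
    if w: "w \<in> words k d" "w' \<in> words k d" "w \<noteq> w'" and i: "i = decisive_index k d lt T le w w'" for w w' i
  proof -
    have len: "length w = d" "length w' = d" and sub: "set w \<subseteq> A" "set w' \<subseteq> A"
      using w by (simp_all add: words_def A)
    have inA: "w ! j \<in> A" "w' ! j \<in> A" if "j < d" for j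
      using subsetD[OF sub(1) nth_mem] subsetD[OF sub(2) nth_mem] that len by simp_all
    let ?wt = "\<lambda>j. H.weight (w ! j) (w' ! j)"
    let ?C = "\<lambda>i. i < d \<and> w ! i \<noteq> w' ! i \<and> (\<forall>j<d. w ! j \<noteq> w' ! j \<longrightarrow> ?wt j \<le> ?wt i)"
    have "(lowest_common k lt T (w ! j) (w' ! j), lowest_common k lt T (w ! i) (w' ! i)) \<in> le \<longleftrightarrow> ?wt j \<le> ?wt i"
      if "i < d" "j < d" "w ! i \<noteq> w' ! i" "w ! j \<noteq> w' ! j" for i j
      using lca[OF inA[OF that(1)] that(3)] lca[OF inA[OF that(2)] that(4)]
      by (simp add: le_def label_order_def)
    then have i': "i = (LEAST i. ?C i)"
      unfolding i decisive_index_def by (intro arg_cong[where f = Least] ext) blast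
    let ?D = "{j. j < d \<and> w ! j \<noteq> w' ! j}"
    have "?D \<noteq> {}" using w(3) len by (auto simp: list_eq_iff_nth_eq)
    then have "Max (?wt ` ?D) \<in> ?wt ` ?D" by (intro Max_in) auto
    then obtain i0 where i0: "i0 \<in> ?D" "Max (?wt ` ?D) = ?wt i0" by blast
    have "?wt j \<le> ?wt i0" if "j \<in> ?D" for j
      unfolding i0(2)[symmetric] using that by (intro Max_ge) auto
    with i0(1) have "?C i0" by simp
    then have Ci: "?C i" unfolding i' by (rule LeastI)
    \<comment> \<open>An earlier column of at least the same weight would itself be a candidate for
      the least index.\<close>
    have before: "?wt j < ?wt i" if "j < i" "w ! j \<noteq> w' ! j" for j
    proof (rule ccontr)
      assume "\<not> ?thesis"
      with Ci that have "?C j" by (meson le_trans less_trans not_le)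
      then have "i \<le> j" unfolding i' by (rule Least_le)
      with that show False by simp
    qed
    have sym: "H.weight (w' ! j) (w ! j) = ?wt j" if "j < d" for j
      using H.weight_sym inA[OF that] by blast
    show ?thesis
    proof (cases "H.less (w ! i) (w' ! i)")
      case True
      have "P w w'"
        by (rule H.dominating_column[of w w' i]) (use len sub assms Ci before True in auto)
      with True show ?thesis by (simp add: lt_def)
    next
      case False
      with Ci inA H.less_total have less: "H.less (w' ! i) (w ! i)" by metis
      have "P w' w"
        by (rule H.dominating_column[of w' w i]) (use len sub assms Ci before less sym in auto)
      with False H.asym show ?thesis by (auto simp: lt_def)
    qed
  qed
  have "tree_ordering k d lt T le = {(w, w'). w \<in> words k d \<and> w' \<in> words k d \<and> P w w'}"
    unfolding tree_ordering_def Let_def using decide H.irrefl by blast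
  with tree len lin show ?thesis by blast
qed

section \<open>From the recursive encoding to symbols\<close>

lemma pword_params: "pword k m p \<Longrightarrow> k \<le> x \<Longrightarrow> x < k + m \<Longrightarrow> x \<in> set p"
  by (induction k m p rule: pword.induct) (fastforce simp: Suc_le_eq le_less)+

lemma psub_inj:
  assumes p: "p \<in> pwords k l n" and len: "length v = l" "length w = l" and eq: "psub k v p = psub k w p"
  shows "v = w"
proof (rule nth_equalityI)
  fix i assume "i < length v"
  with p len have "k + i \<in> set p" by (intro pword_params[of k l]) (auto simp: pwords_def)
  with eq have "(if k + i < k then k + i else v ! (k + i - k)) = (if k + i < k then k + i else w ! (k + i - k))"
    unfolding psub_def map_eq_conv by blast
  then show "v ! i = w ! i" by simp
qed (simp add: len)

lemma pword_earlier_param: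
  assumes "pword k m p" "i < j" "j < m" "t < length p" "p ! t = k + j"
  shows "\<exists>s<t. p ! s = k + i"
  using assms
proof (induction p arbitrary: k m i j t)
  case (Cons x p)
  show ?case
  proof (cases "x < k")
    case True
    with Cons.prems obtain t' where t': "t = Suc t'" "t' < length p" "p ! t' = k + j"
      by (cases t) auto
    from True Cons.prems have "pword k m p" by auto
    from Cons.IH[OF this Cons.prems(2,3) t'(2,3)] show ?thesis using t'(1) by auto
  next
    case False
    with Cons.prems have x: "x = k" "pword (Suc k) (m - 1) p" by auto
    with Cons.prems obtain t' where t': "t = Suc t'" "t' < length p" "p ! t' = k + j"
      by (cases t) auto
    show ?thesis
    proof (cases i)
      case 0
      with x t' show ?thesis by (intro exI[of _ 0]) simp
    next
      case (Suc i')
      with Cons.prems have "i' < j - 1" "j - 1 < m - 1" "p ! t' = Suc k + (j - 1)" using t' by auto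
      from Cons.IH[OF x(2) this(1,2) t'(2) this(3)] Suc t'(1) show ?thesis by auto
    qed
  qed
qed simp

text \<open>Letters start at \<open>0\<close> in \<open>pword\<close> but at \<open>1\<close> in
  \<open>words\<close>; parameters are counted from \<open>0\<close> on both sides.\<close>

definition to_symbol :: "nat \<Rightarrow> nat \<Rightarrow> symbol" where
  "to_symbol k x = (if x < k then Letter (Suc x) else Star (x - k))"

lemma to_symbol_eq_Star: "to_symbol k x = Star i \<longleftrightarrow> x = k + i"
  by (auto simp: to_symbol_def)

lemma canonical_to_symbol:
  assumes "p \<in> pwords k d n"
  shows "map (to_symbol k) p \<in> canonical_param_words k d n"
proof -
  let ?s = "map (to_symbol k) p"
  have p: "pword k d p" "length p = n" using assms by (simp_all add: pwords_def)
  have "set ?s \<subseteq> Letter ` {1..k} \<union> Star ` {..<d}"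
    using pword_less[OF p(1)] by (force simp: to_symbol_def)
  moreover have star: "Star i \<in> set ?s" if "i < d" for i
    using pword_params[OF p(1), of "k + i"] that by (force simp: to_symbol_def)
  moreover have "strict_mono_on {..<d} (first_occurrence ?s)"
  proof (rule strict_mono_onI)
    fix i j assume "i \<in> {..<d}" "j \<in> {..<d}" "i < j"
    let ?t = "first_occurrence ?s j"
    have "\<exists>t<length ?s. ?s ! t = Star j" using star \<open>j \<in> {..<d}\<close> by (metis in_set_conv_nth lessThan_iff)
    then have st: "?t < length ?s \<and> ?s ! ?t = Star j"
      unfolding first_occurrence_def by (rule LeastI_ex)
    then have "?t < length p" by simp
    moreover from st this have "to_symbol k (p ! ?t) = Star j" by simp
    ultimately have t: "?t < length p" "p ! ?t = k + j" by (simp_all only: to_symbol_eq_Star)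
    obtain s where s: "s < ?t" "p ! s = k + i"
      using pword_earlier_param[OF p(1) \<open>i < j\<close> _ t] \<open>j \<in> {..<d}\<close> by auto
    with t have "s < length ?s \<and> ?s ! s = Star i" by (simp add: to_symbol_eq_Star)
    then have "first_occurrence ?s i \<le> s" unfolding first_occurrence_def by (rule Least_le)
    with s show "first_occurrence ?s i < ?t" by simp
  qed
  ultimately show ?thesis using p by (auto simp: canonical_param_words_def param_words_def)
qed

lemma subst_word_to_symbol:
  assumes "p \<in> pwords k d n" "w \<in> words k d"
  shows "subst_word (map (to_symbol k) p) w = map Suc (psub k (map (\<lambda>a. a - 1) w) p)"
proof -
  have "subst_symbol w (to_symbol k x) = Suc (if x < k then x else map (\<lambda>a. a - 1) w ! (x - k))"
    if "x \<in> set p" for x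
  proof (cases "x < k")
    case False
    then have i: "x - k < length w"
      using assms pword_less[of k d p x] that by (auto simp: pwords_def words_def)
    then have "w ! (x - k) \<in> {1..k}" using assms(2) nth_mem by (fastforce simp: words_def)
    with False i show ?thesis by (simp add: to_symbol_def)
  qed (simp add: to_symbol_def)
  then show ?thesis by (simp add: subst_word_def psub_def)
qed

section \<open>Homogeneity from Graham-Rothschild\<close>

lemma distinct_column_types:
  "distinct (column_types X zs) \<and> set (column_types X zs) \<subseteq> set zs - X"
  by (induction X zs rule: column_types.induct) auto

text \<open>A new off-diagonal type opens a parameter of \<open>q\<close>, a repeated one reuses it,
  and a column with equal entries becomes a letter. Evaluating at the first or second entries of the
  types recovers the two words; \<open>ss\<close> lists the types already numbered.\<close>

lemma encode_columns:
  assumes "\<And>z. z \<in> set zs \<Longrightarrow> g (fst z) < k"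
  shows "\<exists>q. length q = length zs \<and> pword (k + length ss) (length (column_types (set ss) zs)) q
    \<and> (\<forall>\<pi> \<in> {fst, snd}. psub k (map (g \<circ> \<pi>) (ss @ column_types (set ss) zs)) q = map (g \<circ> \<pi>) zs)"
  using assms
proof (induction zs arbitrary: ss)
  case Nil
  then show ?case by (simp add: psub_def)
next
  case (Cons z zs)
  then have gz: "g (fst z) < k" by simp
  have psub_Cons: "psub k v (x # q) = psub k v [x] @ psub k v q" for v x q
    by (simp add: psub_def)
  have IH: "\<exists>q. length q = length zs \<and> pword (k + length ss) (length (column_types (set ss) zs)) q
    \<and> (\<forall>\<pi> \<in> {fst, snd}. psub k (map (g \<circ> \<pi>) (ss @ column_types (set ss) zs)) q = map (g \<circ> \<pi>) zs)" for ss
    by (rule Cons.IH) (rule Cons.prems, simp)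
  show ?case
  proof (cases "fst z = snd z \<or> z \<in> set ss")
    case True
    let ?ts = "column_types (set ss) zs"
    obtain x where x: "x < k + length ss" "\<And>\<pi>. \<pi> \<in> {fst, snd} \<Longrightarrow> psub k (map (g \<circ> \<pi>) (ss @ ?ts)) [x] = [g (\<pi> z)]"
    proof (cases "z \<in> set ss")
      case True
      then obtain j where "j < length ss" "ss ! j = z" by (metis in_set_conv_nth)
      then show ?thesis by (intro that[of "k + j"]) (simp_all add: psub_def nth_append)
    next
      case False
      with True gz show ?thesis by (intro that[of "g (fst z)"]) (auto simp: psub_def)
    qed
    have ct: "column_types (set ss) (z # zs) = ?ts" using True by simp
    obtain q where q: "length q = length zs" "pword (k + length ss) (length ?ts) q"
      "\<And>\<pi>. \<pi> \<in> {fst, snd} \<Longrightarrow> psub k (map (g \<circ> \<pi>) (ss @ ?ts)) q = map (g \<circ> \<pi>) zs"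
      using IH[of ss] by blast
    have "psub k (map (g \<circ> \<pi>) (ss @ ?ts)) (x # q) = map (g \<circ> \<pi>) (z # zs)" if "\<pi> \<in> {fst, snd}" for \<pi>
      by (subst psub_Cons) (simp only: x(2)[OF that] q(3)[OF that] append.simps list.map o_apply)
    note vec = this
    show ?thesis unfolding ct
      by (intro exI[of _ "x # q"] conjI ballI) ((rule vec, assumption) | use q(1,2) x(1) in simp)+
  next
    case False
    let ?ss = "ss @ [z]"
    let ?ts = "column_types (set ?ss) zs"
    have ct: "column_types (set ss) (z # zs) = z # ?ts" using False by simp
    have ss: "ss @ z # ?ts = ?ss @ ?ts" by simp
    obtain q where q: "length q = length zs" "pword (k + length ?ss) (length ?ts) q"
      "\<And>\<pi>. \<pi> \<in> {fst, snd} \<Longrightarrow> psub k (map (g \<circ> \<pi>) (?ss @ ?ts)) q = map (g \<circ> \<pi>) zs"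
      using IH[of ?ss] by blast
    have x: "psub k (map (g \<circ> \<pi>) (?ss @ ?ts)) [k + length ss] = [g (\<pi> z)]" for \<pi>
      by (simp add: psub_def nth_append)
    have "psub k (map (g \<circ> \<pi>) (?ss @ ?ts)) ((k + length ss) # q) = map (g \<circ> \<pi>) (z # zs)"
      if "\<pi> \<in> {fst, snd}" for \<pi>
      by (subst psub_Cons) (simp only: x q(3)[OF that] append.simps list.map o_apply)
    note vec = this
    show ?thesis unfolding ct ss
      by (intro exI[of _ "(k + length ss) # q"] conjI ballI) ((rule vec, assumption) | use q(1,2) in simp)+
  qed
qed

text \<open>The number of parameters must be \<open>m\<close> for every pair. Surplus ones go to the
  end, where both words carry the padding letter \<open>0\<close>, so they receive the value
  \<open>0\<close>. The points \<open>u\<close> depend only on the column types.\<close>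

lemma factor_columns:
  assumes g: "\<And>z. z \<in> set zs \<Longrightarrow> g (fst z) < k"
    and k: "0 < k" and r: "length (column_types {} zs) \<le> m" and L: "length zs + m \<le> N"
  defines "u \<equiv> \<lambda>\<pi>. map (g \<circ> \<pi>) (column_types {} zs) @ replicate (m - length (column_types {} zs)) 0"
  shows "\<exists>q \<in> pwords k m N. \<forall>\<pi> \<in> {fst, snd}. psub k (u \<pi>) q = map (g \<circ> \<pi>) zs @ replicate (N - length zs) 0"
proof -
  let ?ts = "column_types {} zs"
  let ?r = "length ?ts"
  obtain q where q: "length q = length zs" "pword k ?r q"
    and sub: "\<And>\<pi>. \<pi> \<in> {fst, snd} \<Longrightarrow> psub k (map (g \<circ> \<pi>) ?ts) q = map (g \<circ> \<pi>) zs"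
    using encode_columns[of zs g k "[]"] g by (simp del: insert_iff) blast
  let ?q = "(q @ replicate (N - length zs - (m - ?r)) 0) @ [k + ?r..<k + ?r + (m - ?r)]"
  have "pword k (?r + 0) (q @ replicate (N - length zs - (m - ?r)) 0)"
    by (rule pword_append) (use q k in \<open>auto simp: pword_0\<close>)
  then have "pword k (?r + 0 + (m - ?r)) ?q"
    by (rule pword_append) (use pword_upt[of "k + ?r" "m - ?r"] in simp)
  then have mem: "?q \<in> pwords k m N" using r L q by (simp add: pwords_def)
  have "psub k (u \<pi>) ?q = map (g \<circ> \<pi>) zs @ replicate (N - length zs) 0" if "\<pi> \<in> {fst, snd}" for \<pi>
  proof -
    have "psub k (u \<pi>) q = map (g \<circ> \<pi>) zs"
      unfolding u_def using psub_append_left[of q k ?r "length zs"] q sub[OF that] by (simp add: pwords_def)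
    moreover have "psub k (u \<pi>) (replicate i 0) = replicate i 0" for i
      using k by (simp add: psub_def)
    moreover have "psub k (u \<pi>) [k + ?r..<k + ?r + (m - ?r)] = replicate (m - ?r) 0"
      by (rule nth_equalityI) (auto simp: psub_def u_def nth_append)
    moreover have "replicate (N - length zs) 0 = replicate (N - length zs - (m - ?r)) 0 @ replicate (m - ?r) (0 :: nat)"
      using L by (simp add: replicate_add[symmetric])
    ultimately show ?thesis by simp
  qed
  with mem show ?thesis by blast
qed

text \<open>The colour of a parameter word is a subset of \<open>?U \<times> ?U\<close>, coded as a
  number by \<open>h\<close>; the common colour is the relation \<open>Q\<close>.\<close>

lemma homogeneous_subspace:
  assumes "0 < k"
  shows "\<exists>n. \<forall>R :: nat list rel. \<exists>p \<in> pwords k N n. \<exists>Q. \<forall>q \<in> pwords k m N. \<forall>u \<in> pwords k 0 m. \<forall>u' \<in> pwords k 0 m.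
    (map Suc (psub k (psub k u q) p), map Suc (psub k (psub k u' q) p)) \<in> R \<longleftrightarrow> (u, u') \<in> Q"
proof -
  let ?U = "pwords k 0 m"
  obtain h :: "nat list rel \<Rightarrow> nat" where h: "inj_on h (Pow (?U \<times> ?U))"
    using finite_imp_inj_to_nat_seg[of "Pow (?U \<times> ?U)"] finite_pwords by auto
  have "ramsey k m" using graham_rothschild[of "k - 1" m] assms by simp
  moreover have "finite (h ` Pow (?U \<times> ?U))" using finite_pwords by simp
  ultimately obtain n where n: "\<forall>\<chi> :: nat list \<Rightarrow> nat. range \<chi> \<subseteq> h ` Pow (?U \<times> ?U) \<longrightarrow>
     (\<exists>p \<in> pwords k N n. \<exists>c. \<forall>q \<in> pwords k m N. \<chi> (psub k q p) = c)"
    unfolding ramsey_def by meson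
  show ?thesis
  proof (intro exI[of _ n] allI)
    fix R :: "nat list rel"
    define F where "F x = {(u, u') \<in> ?U \<times> ?U. (map Suc (psub k u x), map Suc (psub k u' x)) \<in> R}" for x
    have F: "F x \<in> Pow (?U \<times> ?U)" for x unfolding F_def by blast
    then have "range (\<lambda>x. h (F x)) \<subseteq> h ` Pow (?U \<times> ?U)" by blast
    with n obtain p c where p: "p \<in> pwords k N n" and c: "\<forall>q \<in> pwords k m N. h (F (psub k q p)) = c" by blast
    have "(map Suc (psub k (psub k u q) p), map Suc (psub k (psub k u' q) p)) \<in> R \<longleftrightarrow>
        (u, u') \<in> F (psub k (SOME q. q \<in> pwords k m N) p)"
      if q: "q \<in> pwords k m N" and u: "u \<in> ?U" "u' \<in> ?U" for q u u'
    proof -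
      have "(SOME q. q \<in> pwords k m N) \<in> pwords k m N" using q by (rule someI)
      with c q have "h (F (psub k (SOME q. q \<in> pwords k m N) p)) = h (F (psub k q p))" by simp
      then have "F (psub k (SOME q. q \<in> pwords k m N) p) = F (psub k q p)"
        using h F by (meson inj_onD)
      moreover have "psub k v (psub k q p) = psub k (psub k v q) p" for v
        by (rule psub_psub[OF p]) (use q in \<open>simp_all add: pwords_def\<close>)
      ultimately show ?thesis using u by (simp add: F_def)
    qed
    with p show "\<exists>p \<in> pwords k N n. \<exists>Q. \<forall>q \<in> pwords k m N. \<forall>u \<in> ?U. \<forall>u' \<in> ?U.
      (map Suc (psub k (psub k u q) p), map Suc (psub k (psub k u' q) p)) \<in> R \<longleftrightarrow> (u, u') \<in> Q"
      by blast
  qed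
qed

theorem theorem4:
  fixes k d :: nat
  assumes "k \<ge> 1" and "d \<ge> 1"
  shows "\<exists>n. \<forall>R. strict_linear_ordering (words k n) R \<longrightarrow>
    (\<exists>C \<in> subcubes k d n. \<exists>p \<in> canonical_param_words k d n. C = induced_subcube k d p \<and>
      (\<exists>T le lt. weakly_decreasing_schroeder_tree T le \<and> length (leaves T) = k
         \<and> strict_linear_ordering {1..k} lt
         \<and> restrict_ordering k d R p = tree_ordering k d lt T le))"
proof -
  \<comment> \<open>There are at most \<open>k * k\<close> column types. The bound
    \<open>d + 3\<close> admits the cycles with three columns and one duplicate beside
    \<open>d\<close> columns; the \<open>m\<close> coordinates of \<open>N\<close> beyond
    \<open>M\<close> take the surplus parameters.\<close>
  define M m where "M = d + 3" and "m = k * k"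
  define N where "N = M + m"
  define A where "A = {1..k}"
  have k: "0 < k" using assms by simp
  from homogeneous_subspace[OF k] obtain n where n: "\<forall>R :: nat list rel. \<exists>p \<in> pwords k N n. \<exists>Q. \<forall>q \<in> pwords k m N. \<forall>u \<in> pwords k 0 m. \<forall>u' \<in> pwords k 0 m.
    (map Suc (psub k (psub k u q) p), map Suc (psub k (psub k u' q) p)) \<in> R \<longleftrightarrow> (u, u') \<in> Q"
    by (rule exE)
  show ?thesis
  proof (intro exI[of _ n] allI impI)
    fix R assume R: "strict_linear_ordering (words k n) R"
    from n[THEN spec, of R] obtain p where p: "p \<in> pwords k N n"
      and "\<exists>Q. \<forall>q \<in> pwords k m N. \<forall>u \<in> pwords k 0 m. \<forall>u' \<in> pwords k 0 m.
        (map Suc (psub k (psub k u q) p), map Suc (psub k (psub k u' q) p)) \<in> R \<longleftrightarrow> (u, u') \<in> Q"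
      by (rule bexE)
    from this(2) obtain Q where Q: "\<forall>q \<in> pwords k m N. \<forall>u \<in> pwords k 0 m. \<forall>u' \<in> pwords k 0 m.
        (map Suc (psub k (psub k u q) p), map Suc (psub k (psub k u' q) p)) \<in> R \<longleftrightarrow> (u, u') \<in> Q"
      by (rule exE)
    \<comment> \<open>Letters are moved down by one, and words of every length up to
      \<open>M\<close> become points of the same cube.\<close>
    define pad where "pad w = map (\<lambda>a. a - 1) w @ replicate (N - length w) 0" for w :: "nat list"
    define emb where "emb w = map Suc (psub k (pad w) p)" for w
    define P where "P w w' \<longleftrightarrow> (emb w, emb w') \<in> R" for w w'
    have pad: "pad w \<in> pwords k 0 N" if "length w \<le> M" "set w \<subseteq> A" for w
      using that k by (force simp: pad_def pwords_def pword_0 A_def N_def)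
    have emb: "emb w \<in> words k n" if "length w \<le> M" "set w \<subseteq> A" for w
    proof -
      have "psub k (pad w) p \<in> pwords k 0 n" by (rule psub_in_pwords[OF p pad[OF that]]) simp
      then show ?thesis by (auto simp: emb_def words_def pwords_def pword_0 Suc_le_eq)
    qed
    have emb_inj: "v = w" if "length v = length w" "length v \<le> M" "set v \<subseteq> A" "set w \<subseteq> A" "emb v = emb w" for v w
    proof -
      have "psub k (pad v) p = psub k (pad w) p" using that(5) by (simp add: emb_def)
      then have "pad v = pad w" using psub_inj[OF p] pad that by (simp add: pwords_def)
      then have eq: "map (\<lambda>a. a - 1) v = map (\<lambda>a. a - 1) w" using that(1) by (simp add: pad_def)
      show ?thesis
      proof (rule nth_equalityI)
        fix i assume i: "i < length v"
        then have "v ! i \<in> A" "w ! i \<in> A" using that nth_mem by (metis subsetD)+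
        moreover have "v ! i - 1 = w ! i - 1" using eq i that(1) by (metis nth_map)
        ultimately show "v ! i = w ! i" by (auto simp: A_def)
      qed (rule that(1))
    qed
    have hom: "homogeneous_order A M P"
    proof
      show "finite A" "3 \<le> M" by (simp_all add: A_def M_def)
      show "\<not> P w w" for w
        using R by (auto simp: P_def strict_linear_ordering_def strict_linear_order_on_def irrefl_def)
      show "P u w" if "P u v" "P v w" for u v w
        using R that unfolding P_def strict_linear_ordering_def strict_linear_order_on_def
        by (meson transD)
      show "P v w \<or> P w v" if "length v = length w" "length v \<le> M" "set v \<subseteq> A" "set w \<subseteq> A" "v \<noteq> w" for v w
      proof -
        have "emb v \<noteq> emb w" using emb_inj that by blast
        moreover have "emb v \<in> words k n" "emb w \<in> words k n" using emb that by simp_all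
        ultimately show ?thesis
          using R unfolding P_def strict_linear_ordering_def strict_linear_order_on_def total_on_def
          by blast
      qed
    next
      fix zs zs' :: "(nat \<times> nat) list"
      assume len: "length zs \<le> M" "length zs' \<le> M" and A: "set zs \<subseteq> A \<times> A" "set zs' \<subseteq> A \<times> A"
        and ct: "column_types {} zs = column_types {} zs'" and P: "P (map fst zs) (map snd zs)"
      let ?g = "\<lambda>a :: nat. a - 1"
      define u where "u \<pi> = map (?g \<circ> \<pi>) (column_types {} zs) @ replicate (m - length (column_types {} zs)) 0"
        for \<pi> :: "nat \<times> nat \<Rightarrow> nat"
      have ctA: "set (column_types {} zs) \<subseteq> A \<times> A" using distinct_column_types[of "{}" zs] A by blast
      have "length (column_types {} zs) = card (set (column_types {} zs))"
        using distinct_column_types[of "{}" zs] by (simp add: distinct_card)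
      also have "\<dots> \<le> card (A \<times> A)" by (rule card_mono[OF _ ctA]) (simp add: A_def)
      finally have r: "length (column_types {} zs) \<le> m" by (simp add: m_def A_def)
      have u: "u \<pi> \<in> pwords k 0 m" if "\<pi> \<in> {fst, snd}" for \<pi>
        using that r k ctA by (force simp: u_def pwords_def pword_0 A_def)
      have key: "P (map fst xs) (map snd xs) \<longleftrightarrow> (u fst, u snd) \<in> Q"
        if xs: "length xs \<le> M" "set xs \<subseteq> A \<times> A" "column_types {} xs = column_types {} zs" for xs
      proof -
        have g: "?g (fst z) < k" if "z \<in> set xs" for z using xs that by (force simp: A_def)
        have "length (column_types {} xs) \<le> m" "length xs + m \<le> N" using r xs by (simp_all add: N_def)
        from factor_columns[of xs ?g, OF g k this] obtain q where q: "q \<in> pwords k m N"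
          and sub: "\<forall>\<pi> \<in> {fst, snd}. psub k (u \<pi>) q = map (?g \<circ> \<pi>) xs @ replicate (N - length xs) 0"
          unfolding u_def xs(3) by blast
        have "emb (map \<pi> xs) = map Suc (psub k (psub k (u \<pi>) q) p)" if "\<pi> \<in> {fst, snd}" for \<pi>
          by (simp add: emb_def pad_def bspec[OF sub that])
        then show ?thesis using Q q u by (simp add: P_def)
      qed
      show "P (map fst zs') (map snd zs')"
        using key[OF len(1) A(1) refl] key[OF len(2) A(2) ct[symmetric]] P by blast
    qed
    obtain T le lt where T: "weakly_decreasing_schroeder_tree T le" "length (leaves T) = k"
      "strict_linear_ordering {1..k} lt"
      "tree_ordering k d lt T le = {(w, w'). w \<in> words k d \<and> w' \<in> words k d \<and> P w w'}"
      using tree_representation[OF hom assms(1) _ A_def, of d] by (auto simp: M_def)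
    \<comment> \<open>Only the first \<open>d\<close> coordinates of the homogeneous subspace move
      and the others keep the padding letter, so the points of this subcube are the words
      \<open>emb w\<close>.\<close>
    let ?e = "[k..<k + d] @ replicate (N - d) 0"
    have "pword k (d + 0) ?e"
      by (rule pword_append[OF pword_upt]) (use k in \<open>simp add: pword_0\<close>)
    then have e: "?e \<in> pwords k d N" by (simp add: pwords_def N_def M_def)
    let ?p = "psub k ?e p"
    have p': "?p \<in> pwords k d n" by (rule psub_in_pwords[OF p e]) simp
    let ?s = "map (to_symbol k) ?p"
    have s: "?s \<in> canonical_param_words k d n" by (rule canonical_to_symbol[OF p'])
    have "subst_word ?s w = emb w" if w: "w \<in> words k d" for w
    proof -
      let ?v = "map (\<lambda>a. a - 1) w"
      have lw: "length w = d" using w by (simp add: words_def)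
      have "psub k ?v [k..<k + d] = ?v"
        by (rule nth_equalityI) (use lw in \<open>auto simp: psub_def\<close>)
      moreover have "psub k ?v (replicate (N - d) 0) = replicate (N - d) 0"
        using k by (simp add: psub_def)
      ultimately have "psub k ?v ?e = pad w" using lw by (simp add: pad_def)
      moreover have "psub k ?v ?p = psub k (psub k ?v ?e) p"
        by (rule psub_psub[OF p]) (use e in \<open>simp_all add: pwords_def\<close>)
      ultimately show ?thesis using subst_word_to_symbol[OF p' w] by (simp add: emb_def)
    qed
    then have "restrict_ordering k d R ?s = tree_ordering k d lt T le"
      unfolding T(4) restrict_ordering_def P_def by auto
    moreover have "induced_subcube k d ?s \<in> subcubes k d n"
      using s by (simp add: subcubes_def canonical_param_words_def)
    ultimately show "\<exists>C \<in> subcubes k d n. \<exists>p \<in> canonical_param_words k d n. C = induced_subcube k d p \<and>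
      (\<exists>T le lt. weakly_decreasing_schroeder_tree T le \<and> length (leaves T) = k
         \<and> strict_linear_ordering {1..k} lt
         \<and> restrict_ordering k d R p = tree_ordering k d lt T le)"
      using s T(1,2,3) by blast
  qed
qed

end
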